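(* Let $C\subseteq K$ be a Cartesian effect category with (left and right) sequential products $\ltimes,\rtimes$. Let $a,l,r,c$ be the natural isomorphisms on $C$ given by its finite products: $a_{X_1,X_2,X_3}:(X_1\times X_2)\times X_3\to X_1\times(X_2\times X_3)$, $l_X:X\times 1\to X$, $r_X:1\times X\to X$, $c_{X_1,X_2}:X_1\times X_2\to X_2\times X_1$. Let $J:C\to K$ be the inclusion, let $\otimes:|K|\times K\to K$ and $\otimes:K\times|K|\to K$ be the restrictions of $\ltimes$ and $\rtimes$, respectively, and let $I=1$. Then these data form a Freyd-category, and in this Freyd-category the graph homomorphisms $\ltimes_{\mathrm{Fr}}$ and $\rtimes_{\mathrm{Fr}}$ coincide with $\ltimes$ and $\rtimes$, respectively.
   Context: **Cartesian effect categories.** A subcategory $C$ of a category $K$ is wide if it has the same objects as $K$; morphisms of $K$ lying in $C$ are called pure. A pure terminal object is an object $1$ that is terminal in $C$, and $\langle\,\rangle_X:X\to 1$ denotes the unique pure morphism. The effect of $f:X\to Y$ in $K$ is $\mathcal{E}(f)=\langle\,\rangle_Y\circ f$; for $f:X\to Y$ and $f':X\to Y'$, write $f\approx f'$ iff $\mathcal{E}(f)=\mathcal{E}(f')$. A consistency relation $\lhd$ is a relation between parallel morphisms of $K$, the second one being pure, such that (i) $v\lhd v$ for every pure $v$; (ii) for all $f:X\to Y$, $g:Y\to Z$ in $K$ and all pure $u:Y\to Y'$, $v:X\to Y'$, $w:Y'\to Z$, if $u\circ f\lhd v$ and $g\lhd w\circ u$ then $g\circ f\lhd w\circ v$. Write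 $f\lhd\rhd f'$ iff there is a pure $v$ with $f\lhd v$ and $f'\lhd v$. An effect category consists of a category $K$, a wide subcategory $C$, a pure terminal object $1$ and a consistency relation $\lhd$ satisfying complementarity: for parallel $f,f'$, if $f\approx f'$ and $f\lhd\rhd f'$ then $f=f'$. A Cartesian effect category is an effect category in which $C$ has chosen finite products (terminal object $1$, binary products $\times$), together with two graph homomorphisms $\ltimes:C\times K\to K$ and $\rtimes:K\times C\to K$ (the semi-pure products), sending $(X_1,X_2)$ to $X_1\times X_2$ on objects, both extending $\times$ on pairs of pure morphisms, and such that, with projections $p_i:X_1\times X_2\to X_i$ and $q_i:Y_1\times Y_2\to Y_i$: for all pure $v_1:X_1\to Y_1$ and all $f_2:X_2\to Y_2$ in $K$, $v_1\ltimes f_2:X_1\times X_2\to Y_1\times Y_2$ is the unique morphism of $K$ with $q_1\circ(v_1\ltimes f_2)\lhd v_1\circ p_1$ and $q_2\circ(v_1\ltimes f_2)=f_2\circ p_2$; and for all $f_1:X_1\to Y_1$ in $K$ and all pure $v_2:X_2\to Y_2$, $f_1\rtimes v_2$ is the unique morphism of $K$ with $q_1\circ(f_1\rtimes v_2)=f_1\circ p_1$ and $q_2\circ(f_1\rtimes v_2)\lhd v_2\circ p_2$. **Sequential products.** For arbitrary $f_1:X_1\to Y_1$, $f_2:X_2\to Y_2$ in $K$, the left and right sequential products are $f_1\ltimes f_2=(\mathrm{id}_{Y_1}\ltimes f_2)\circ(f_1\rtimes\mathrm{id}_{X_2})$ and $f_1\rtimes f_2=(f_1\rtimes\mathrm{id}_{Y_2})\circ(\mathrm{id}_{X_1}\ltimes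 f_2)$, where semi-pure products are used on the right-hand sides. They extend the semi-pure products, so the same symbols are used. **Freyd-categories.** $|K|$ denotes the smallest wide subcategory of $K$ (objects and identities only). A binoidal category is a category $K$ with two functors $\otimes:|K|\times K\to K$ and $\otimes:K\times|K|\to K$ which coincide on $|K|^2$. In a binoidal category, for $f_1:X_1\to Y_1$ and $f_2:X_2\to Y_2$, put $f_1\ltimes_{\mathrm{Fr}}f_2=(\mathrm{id}_{Y_1}\otimes f_2)\circ(f_1\otimes\mathrm{id}_{X_2})$ and $f_1\rtimes_{\mathrm{Fr}}f_2=(f_1\otimes\mathrm{id}_{Y_2})\circ(\mathrm{id}_{X_1}\otimes f_2)$. A morphism $k$ is central if for all $f$ in $K$, $k\ltimes_{\mathrm{Fr}}f=k\rtimes_{\mathrm{Fr}}f$ and $f\ltimes_{\mathrm{Fr}}k=f\rtimes_{\mathrm{Fr}}k$. A natural transformation is central if all its components are. A symmetric premonoidal category is a binoidal category $K$ with an object $I$ and central natural isomorphisms (natural in each component separately) $a_{X,Y,Z}:(X\otimes Y)\otimes Z\to X\otimes(Y\otimes Z)$, $l_X:X\otimes I\to X$, $r_X:I\otimes X\to X$, $c_{X,Y}:X\otimes Y\to Y\otimes X$, subject to the usual coherence equations for symmetric monoidal categories. A symmetric premonoidal functor between symmetric premonoidal categories is a functor that preserves $\otimes$, $I$ and $a,l,r,c$; it is strict if in addition it maps central morphisms to central morphisms. Every category with finite products is symmetric premonoidal, with $\otimes=\times$. A Freyd-category is an identity-on-objects functor $J:C\to K$ where $C$ has finite products, $K$ is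 symmetric premonoidal and $J$ is strict symmetric premonoidal. *)

theory Defs
  imports "HOL-Library.FuncSet"
begin

record ('o, 'm) cat =
  Obj :: "'o set"
  Arr :: "'m set"
  Dom :: "'m \<Rightarrow> 'o"
  Cod :: "'m \<Rightarrow> 'o"
  Id :: "'o \<Rightarrow> 'm"
  Comp :: "'m \<Rightarrow> 'm \<Rightarrow> 'm" (infixr "\<cdot>\<index>" 70)

text \<open>Composition is in applicative order: \<open>g \<cdot>\<^bsub>K\<^esub> f\<close> is ``g after f''. The operations are only
  meaningful on the carriers \<^const>\<open>Obj\<close> and \<^const>\<open>Arr\<close>.\<close>

definition hom :: "('o, 'm) cat \<Rightarrow> 'o \<Rightarrow> 'o \<Rightarrow> 'm set" where
  "hom K X Y = {f \<in> Arr K. Dom K f = X \<and> Cod K f = Y}"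

locale category =
  fixes K :: "('o, 'm) cat"
  assumes dom_obj: "f \<in> Arr K \<Longrightarrow> Dom K f \<in> Obj K"
    and cod_obj: "f \<in> Arr K \<Longrightarrow> Cod K f \<in> Obj K"
    and id_hom: "X \<in> Obj K \<Longrightarrow> Id K X \<in> hom K X X"
    and comp_hom: "f \<in> hom K X Y \<Longrightarrow> g \<in> hom K Y Z \<Longrightarrow> g \<cdot>\<^bsub>K\<^esub> f \<in> hom K X Z"
    and id_left: "f \<in> hom K X Y \<Longrightarrow> Id K Y \<cdot>\<^bsub>K\<^esub> f = f"
    and id_right: "f \<in> hom K X Y \<Longrightarrow> f \<cdot>\<^bsub>K\<^esub> Id K X = f"
    and comp_assoc: "f \<in> hom K W X \<Longrightarrow> g \<in> hom K X Y \<Longrightarrow> h \<in> hom K Y Z \<Longrightarrow>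
      (h \<cdot>\<^bsub>K\<^esub> g) \<cdot>\<^bsub>K\<^esub> f = h \<cdot>\<^bsub>K\<^esub> (g \<cdot>\<^bsub>K\<^esub> f)"

locale wide_subcategory = K: category K + C: category C
  for K :: "('o, 'm) cat" and C :: "('o, 'm) cat" +
  assumes obj_eq: "Obj C = Obj K"
    and arr_sub: "Arr C \<subseteq> Arr K"
    and dom_eq: "f \<in> Arr C \<Longrightarrow> Dom C f = Dom K f"
    and cod_eq: "f \<in> Arr C \<Longrightarrow> Cod C f = Cod K f"
    and id_eq: "X \<in> Obj C \<Longrightarrow> Id C X = Id K X"
    and comp_eq: "f \<in> hom C X Y \<Longrightarrow> g \<in> hom C Y Z \<Longrightarrow> g \<cdot>\<^bsub>C\<^esub> f = g \<cdot>\<^bsub>K\<^esub> f"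

text \<open>The smallest wide subcategory (written with bars around K in the literature).\<close>

definition discr :: "('o, 'm) cat \<Rightarrow> ('o, 'm) cat" where
  "discr K = K\<lparr>Arr := Id K ` Obj K\<rparr>"

definition prod_cat :: "('o, 'm) cat \<Rightarrow> ('p, 'n) cat \<Rightarrow> ('o \<times> 'p, 'm \<times> 'n) cat" where
  "prod_cat A B =
    \<lparr>Obj = Obj A \<times> Obj B, Arr = Arr A \<times> Arr B,
     Dom = map_prod (Dom A) (Dom B), Cod = map_prod (Cod A) (Cod B),
     Id = map_prod (Id A) (Id B),
     Comp = (\<lambda>(g1, g2) (f1, f2). (g1 \<cdot>\<^bsub>A\<^esub> f1, g2 \<cdot>\<^bsub>B\<^esub> f2))\<rparr>"

definition graph_hom ::
  "('o, 'm) cat \<Rightarrow> ('p, 'n) cat \<Rightarrow> ('o \<Rightarrow> 'p) \<Rightarrow> ('m \<Rightarrow> 'n) \<Rightarrow> bool" where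
  "graph_hom A B Fo Fa \<longleftrightarrow>
    (\<forall>X \<in> Obj A. Fo X \<in> Obj B) \<and>
    (\<forall>f \<in> Arr A. Fa f \<in> hom B (Fo (Dom A f)) (Fo (Cod A f)))"

definition is_functor ::
  "('o, 'm) cat \<Rightarrow> ('p, 'n) cat \<Rightarrow> ('o \<Rightarrow> 'p) \<Rightarrow> ('m \<Rightarrow> 'n) \<Rightarrow> bool" where
  "is_functor A B Fo Fa \<longleftrightarrow>
    category A \<and> category B \<and> graph_hom A B Fo Fa \<and>
    (\<forall>X \<in> Obj A. Fa (Id A X) = Id B (Fo X)) \<and>
    (\<forall>X Y Z. \<forall>f \<in> hom A X Y. \<forall>g \<in> hom A Y Z. Fa (g \<cdot>\<^bsub>A\<^esub> f) = Fa g \<cdot>\<^bsub>B\<^esub> Fa f)"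

definition natural_trans ::
  "('o, 'm) cat \<Rightarrow> ('p, 'n) cat \<Rightarrow> ('o \<Rightarrow> 'p) \<Rightarrow> ('m \<Rightarrow> 'n) \<Rightarrow> ('o \<Rightarrow> 'p) \<Rightarrow> ('m \<Rightarrow> 'n)
    \<Rightarrow> ('o \<Rightarrow> 'n) \<Rightarrow> bool" where
  "natural_trans A B Fo Fa Go Ga t \<longleftrightarrow>
    is_functor A B Fo Fa \<and> is_functor A B Go Ga \<and>
    (\<forall>X \<in> Obj A. t X \<in> hom B (Fo X) (Go X)) \<and>
    (\<forall>X Y. \<forall>f \<in> hom A X Y. t Y \<cdot>\<^bsub>B\<^esub> Fa f = Ga f \<cdot>\<^bsub>B\<^esub> t X)"

definition is_iso :: "('o, 'm) cat \<Rightarrow> 'm \<Rightarrow> bool" where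
  "is_iso K f \<longleftrightarrow> f \<in> Arr K \<and>
    (\<exists>g \<in> hom K (Cod K f) (Dom K f). g \<cdot>\<^bsub>K\<^esub> f = Id K (Dom K f) \<and> f \<cdot>\<^bsub>K\<^esub> g = Id K (Cod K f))"

record ('o, 'm) fprod =
  One :: 'o
  Prod :: "'o \<times> 'o \<Rightarrow> 'o"
  Pr1 :: "'o \<Rightarrow> 'o \<Rightarrow> 'm"
  Pr2 :: "'o \<Rightarrow> 'o \<Rightarrow> 'm"

definition terminal :: "('o, 'm) cat \<Rightarrow> 'o \<Rightarrow> bool" where
  "terminal C t \<longleftrightarrow> t \<in> Obj C \<and> (\<forall>X \<in> Obj C. \<exists>!u. u \<in> hom C X t)"

definition bang :: "('o, 'm) cat \<Rightarrow> 'o \<Rightarrow> 'o \<Rightarrow> 'm" where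
  "bang C t X = (THE u. u \<in> hom C X t)"

locale finite_products = category C for C :: "('o, 'm) cat" +
  fixes P :: "('o, 'm) fprod"
  assumes terminal_One: "terminal C (One P)"
    and Prod_obj: "X \<in> Obj C \<Longrightarrow> Y \<in> Obj C \<Longrightarrow> Prod P (X, Y) \<in> Obj C"
    and Pr1_hom: "X \<in> Obj C \<Longrightarrow> Y \<in> Obj C \<Longrightarrow> Pr1 P X Y \<in> hom C (Prod P (X, Y)) X"
    and Pr2_hom: "X \<in> Obj C \<Longrightarrow> Y \<in> Obj C \<Longrightarrow> Pr2 P X Y \<in> hom C (Prod P (X, Y)) Y"
    and pairing_unique: "f \<in> hom C Z X \<Longrightarrow> g \<in> hom C Z Y \<Longrightarrow>
      \<exists>!h. h \<in> hom C Z (Prod P (X, Y)) \<and> Pr1 P X Y \<cdot>\<^bsub>C\<^esub> h = f \<and> Pr2 P X Y \<cdot>\<^bsub>C\<^esub> h = g"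

definition pairing :: "('o, 'm) cat \<Rightarrow> ('o, 'm) fprod \<Rightarrow> 'm \<Rightarrow> 'm \<Rightarrow> 'm" where
  "pairing C P f g =
    (THE h. h \<in> hom C (Dom C f) (Prod P (Cod C f, Cod C g)) \<and>
      Pr1 P (Cod C f) (Cod C g) \<cdot>\<^bsub>C\<^esub> h = f \<and> Pr2 P (Cod C f) (Cod C g) \<cdot>\<^bsub>C\<^esub> h = g)"

definition prod_arr :: "('o, 'm) cat \<Rightarrow> ('o, 'm) fprod \<Rightarrow> 'm \<times> 'm \<Rightarrow> 'm" where
  "prod_arr C P = (\<lambda>(f, g).
    pairing C P (f \<cdot>\<^bsub>C\<^esub> Pr1 P (Dom C f) (Dom C g)) (g \<cdot>\<^bsub>C\<^esub> Pr2 P (Dom C f) (Dom C g)))"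

text \<open>The canonical maps \<open>(X \<times> Y) \<times> Z \<rightarrow> X \<times> (Y \<times> Z)\<close>, \<open>X \<times> 1 \<rightarrow> X\<close>, \<open>1 \<times> X \<rightarrow> X\<close>,
  \<open>X \<times> Y \<rightarrow> Y \<times> X\<close>.\<close>

definition prod_assoc :: "('o, 'm) cat \<Rightarrow> ('o, 'm) fprod \<Rightarrow> 'o \<Rightarrow> 'o \<Rightarrow> 'o \<Rightarrow> 'm" where
  "prod_assoc C P X Y Z =
    pairing C P (Pr1 P X Y \<cdot>\<^bsub>C\<^esub> Pr1 P (Prod P (X, Y)) Z)
      (pairing C P (Pr2 P X Y \<cdot>\<^bsub>C\<^esub> Pr1 P (Prod P (X, Y)) Z) (Pr2 P (Prod P (X, Y)) Z))"

definition prod_l :: "('o, 'm) fprod \<Rightarrow> 'o \<Rightarrow> 'm" where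
  "prod_l P X = Pr1 P X (One P)"

definition prod_r :: "('o, 'm) fprod \<Rightarrow> 'o \<Rightarrow> 'm" where
  "prod_r P X = Pr2 P (One P) X"

definition prod_swap :: "('o, 'm) cat \<Rightarrow> ('o, 'm) fprod \<Rightarrow> 'o \<Rightarrow> 'o \<Rightarrow> 'm" where
  "prod_swap C P X Y = pairing C P (Pr2 P X Y) (Pr1 P X Y)"

text \<open>In \<open>cns f v\<close> (read \<open>f \<lhd> v\<close>) the morphism \<open>v\<close> is pure.\<close>

locale consistency_relation = wide_subcategory K C
  for K :: "('o, 'm) cat" and C :: "('o, 'm) cat" +
  fixes cns :: "'m \<Rightarrow> 'm \<Rightarrow> bool"
  assumes cns_typed: "cns f v \<Longrightarrow>
      f \<in> Arr K \<and> v \<in> Arr C \<and> Dom K f = Dom K v \<and> Cod K f = Cod K v"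
    and cns_refl: "v \<in> Arr C \<Longrightarrow> cns v v"
    and cns_comp: "f \<in> hom K X Y \<Longrightarrow> g \<in> hom K Y Z \<Longrightarrow>
      u \<in> hom C Y Y' \<Longrightarrow> v \<in> hom C X Y' \<Longrightarrow> w \<in> hom C Y' Z \<Longrightarrow>
      cns (u \<cdot>\<^bsub>K\<^esub> f) v \<Longrightarrow> cns g (w \<cdot>\<^bsub>K\<^esub> u) \<Longrightarrow> cns (g \<cdot>\<^bsub>K\<^esub> f) (w \<cdot>\<^bsub>K\<^esub> v)"

definition effect_of :: "('o, 'm) cat \<Rightarrow> ('o, 'm) cat \<Rightarrow> 'o \<Rightarrow> 'm \<Rightarrow> 'm" where
  "effect_of K C t f = bang C t (Cod K f) \<cdot>\<^bsub>K\<^esub> f"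

definition same_effect :: "('o, 'm) cat \<Rightarrow> ('o, 'm) cat \<Rightarrow> 'o \<Rightarrow> 'm \<Rightarrow> 'm \<Rightarrow> bool" where
  "same_effect K C t f f' \<longleftrightarrow> effect_of K C t f = effect_of K C t f'"

definition consistent :: "('o, 'm) cat \<Rightarrow> ('m \<Rightarrow> 'm \<Rightarrow> bool) \<Rightarrow> 'm \<Rightarrow> 'm \<Rightarrow> bool" where
  "consistent C cns f f' \<longleftrightarrow> (\<exists>v \<in> Arr C. cns f v \<and> cns f' v)"

locale effect_category = consistency_relation K C cns
  for K :: "('o, 'm) cat" and C :: "('o, 'm) cat" and t :: 'o and cns :: "'m \<Rightarrow> 'm \<Rightarrow> bool" +
  assumes pure_terminal: "terminal C t"
    and complementarity: "f \<in> hom K X Y \<Longrightarrow> f' \<in> hom K X Y \<Longrightarrow>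
      same_effect K C t f f' \<Longrightarrow> consistent C cns f f' \<Longrightarrow> f = f'"

text \<open>\<open>lsp\<close> and \<open>rsp\<close> are the semi-pure products \<open>v1 \<ltimes> f2\<close> and \<open>f1 \<rtimes> v2\<close>; both have object map
  \<open>Prod P\<close>. In \<open>lsp_unique\<close>, together with \<open>lsp_graph_hom\<close>, the direction from right to left says
  that \<open>lsp (v1, f2)\<close> has the required property, the other direction is uniqueness.\<close>

locale cartesian_effect_category =
  effect_category K C "One P" cns + finite_products C P
  for K :: "('o, 'm) cat" and C :: "('o, 'm) cat" and P :: "('o, 'm) fprod"
    and cns :: "'m \<Rightarrow> 'm \<Rightarrow> bool" +
  fixes lsp :: "'m \<times> 'm \<Rightarrow> 'm" and rsp :: "'m \<times> 'm \<Rightarrow> 'm"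
  assumes lsp_graph_hom: "graph_hom (prod_cat C K) K (Prod P) lsp"
    and rsp_graph_hom: "graph_hom (prod_cat K C) K (Prod P) rsp"
    and lsp_pure: "v1 \<in> Arr C \<Longrightarrow> v2 \<in> Arr C \<Longrightarrow> lsp (v1, v2) = prod_arr C P (v1, v2)"
    and rsp_pure: "v1 \<in> Arr C \<Longrightarrow> v2 \<in> Arr C \<Longrightarrow> rsp (v1, v2) = prod_arr C P (v1, v2)"
    and lsp_unique: "v1 \<in> hom C X1 Y1 \<Longrightarrow> f2 \<in> hom K X2 Y2 \<Longrightarrow>
      h \<in> hom K (Prod P (X1, X2)) (Prod P (Y1, Y2)) \<Longrightarrow>
      cns (Pr1 P Y1 Y2 \<cdot>\<^bsub>K\<^esub> h) (v1 \<cdot>\<^bsub>K\<^esub> Pr1 P X1 X2) \<and>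
        Pr2 P Y1 Y2 \<cdot>\<^bsub>K\<^esub> h = f2 \<cdot>\<^bsub>K\<^esub> Pr2 P X1 X2
      \<longleftrightarrow> h = lsp (v1, f2)"
    and rsp_unique: "f1 \<in> hom K X1 Y1 \<Longrightarrow> v2 \<in> hom C X2 Y2 \<Longrightarrow>
      h \<in> hom K (Prod P (X1, X2)) (Prod P (Y1, Y2)) \<Longrightarrow>
      Pr1 P Y1 Y2 \<cdot>\<^bsub>K\<^esub> h = f1 \<cdot>\<^bsub>K\<^esub> Pr1 P X1 X2 \<and>
        cns (Pr2 P Y1 Y2 \<cdot>\<^bsub>K\<^esub> h) (v2 \<cdot>\<^bsub>K\<^esub> Pr2 P X1 X2)
      \<longleftrightarrow> h = rsp (f1, v2)"

text \<open>The sequential products, written \<open>f1 \<ltimes> f2\<close> and \<open>f1 \<rtimes> f2\<close> for arbitrary arguments.\<close>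

definition seq_left ::
  "('o, 'm) cat \<Rightarrow> ('m \<times> 'm \<Rightarrow> 'm) \<Rightarrow> ('m \<times> 'm \<Rightarrow> 'm) \<Rightarrow> 'm \<times> 'm \<Rightarrow> 'm" where
  "seq_left K lsp rsp = (\<lambda>(f1, f2). lsp (Id K (Cod K f1), f2) \<cdot>\<^bsub>K\<^esub> rsp (f1, Id K (Dom K f2)))"

definition seq_right ::
  "('o, 'm) cat \<Rightarrow> ('m \<times> 'm \<Rightarrow> 'm) \<Rightarrow> ('m \<times> 'm \<Rightarrow> 'm) \<Rightarrow> 'm \<times> 'm \<Rightarrow> 'm" where
  "seq_right K lsp rsp = (\<lambda>(f1, f2). rsp (f1, Id K (Cod K f2)) \<cdot>\<^bsub>K\<^esub> lsp (Id K (Dom K f1), f2))"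

text \<open>The two tensor functors share the object map \<open>Tens\<close>; \<open>LTens\<close> acts on arrows of
  \<open>discr K \<times> K\<close> and \<open>RTens\<close> on arrows of \<open>K \<times> discr K\<close>.\<close>

record ('o, 'm) binoidal_data =
  Tens :: "'o \<times> 'o \<Rightarrow> 'o"
  LTens :: "'m \<times> 'm \<Rightarrow> 'm"
  RTens :: "'m \<times> 'm \<Rightarrow> 'm"

record ('o, 'm) premonoidal_data = "('o, 'm) binoidal_data" +
  Unit :: 'o
  Assoc :: "'o \<Rightarrow> 'o \<Rightarrow> 'o \<Rightarrow> 'm"
  LUnit :: "'o \<Rightarrow> 'm"
  RUnit :: "'o \<Rightarrow> 'm"
  Swap :: "'o \<Rightarrow> 'o \<Rightarrow> 'm"

locale binoidal = category K for K :: "('o, 'm) cat" +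
  fixes S :: "('o, 'm, 'z) binoidal_data_scheme"
  assumes LTens_functor: "is_functor (prod_cat (discr K) K) K (Tens S) (LTens S)"
    and RTens_functor: "is_functor (prod_cat K (discr K)) K (Tens S) (RTens S)"
    and tens_coincide: "f \<in> Arr (discr K) \<Longrightarrow> g \<in> Arr (discr K) \<Longrightarrow> LTens S (f, g) = RTens S (f, g)"

definition fr_left ::
  "('o, 'm) cat \<Rightarrow> ('o, 'm, 'z) binoidal_data_scheme \<Rightarrow> 'm \<times> 'm \<Rightarrow> 'm" where
  "fr_left K S = (\<lambda>(f1, f2).
    LTens S (Id K (Cod K f1), f2) \<cdot>\<^bsub>K\<^esub> RTens S (f1, Id K (Dom K f2)))"

definition fr_right ::
  "('o, 'm) cat \<Rightarrow> ('o, 'm, 'z) binoidal_data_scheme \<Rightarrow> 'm \<times> 'm \<Rightarrow> 'm" where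
  "fr_right K S = (\<lambda>(f1, f2).
    RTens S (f1, Id K (Cod K f2)) \<cdot>\<^bsub>K\<^esub> LTens S (Id K (Dom K f1), f2))"

definition central :: "('o, 'm) cat \<Rightarrow> ('o, 'm, 'z) binoidal_data_scheme \<Rightarrow> 'm \<Rightarrow> bool" where
  "central K S k \<longleftrightarrow> k \<in> Arr K \<and>
    (\<forall>f \<in> Arr K. fr_left K S (k, f) = fr_right K S (k, f) \<and>
                 fr_left K S (f, k) = fr_right K S (f, k))"

definition central_natural_iso ::
  "('o, 'm) cat \<Rightarrow> ('o, 'm, 'z) binoidal_data_scheme \<Rightarrow>
    ('o \<Rightarrow> 'o) \<Rightarrow> ('m \<Rightarrow> 'm) \<Rightarrow> ('o \<Rightarrow> 'o) \<Rightarrow> ('m \<Rightarrow> 'm) \<Rightarrow> ('o \<Rightarrow> 'm) \<Rightarrow> bool" where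
  "central_natural_iso K S Fo Fa Go Ga t \<longleftrightarrow>
    natural_trans K K Fo Fa Go Ga t \<and> (\<forall>X \<in> Obj K. is_iso K (t X) \<and> central K S (t X))"

definition lwh :: "('o, 'm) cat \<Rightarrow> ('o, 'm, 'z) binoidal_data_scheme \<Rightarrow> 'o \<Rightarrow> 'm \<Rightarrow> 'm" where
  "lwh K S X f = LTens S (Id K X, f)"

definition rwh :: "('o, 'm) cat \<Rightarrow> ('o, 'm, 'z) binoidal_data_scheme \<Rightarrow> 'm \<Rightarrow> 'o \<Rightarrow> 'm" where
  "rwh K S f X = RTens S (f, Id K X)"

text \<open>The coherence equations are those of Mac Lane for symmetric monoidal categories. Note the
  convention \<open>LUnit X : X \<otimes> I \<rightarrow> X\<close> and \<open>RUnit X : I \<otimes> X \<rightarrow> X\<close>.\<close>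

locale symmetric_premonoidal = binoidal K S
  for K :: "('o, 'm) cat" and S :: "('o, 'm) premonoidal_data" +
  assumes Unit_obj: "Unit S \<in> Obj K"
    and Assoc_natural1: "Y \<in> Obj K \<Longrightarrow> Z \<in> Obj K \<Longrightarrow> central_natural_iso K S
      (\<lambda>X. Tens S (Tens S (X, Y), Z)) (\<lambda>f. rwh K S (rwh K S f Y) Z)
      (\<lambda>X. Tens S (X, Tens S (Y, Z))) (\<lambda>f. rwh K S f (Tens S (Y, Z)))
      (\<lambda>X. Assoc S X Y Z)"
    and Assoc_natural2: "X \<in> Obj K \<Longrightarrow> Z \<in> Obj K \<Longrightarrow> central_natural_iso K S
      (\<lambda>Y. Tens S (Tens S (X, Y), Z)) (\<lambda>f. rwh K S (lwh K S X f) Z)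
      (\<lambda>Y. Tens S (X, Tens S (Y, Z))) (\<lambda>f. lwh K S X (rwh K S f Z))
      (\<lambda>Y. Assoc S X Y Z)"
    and Assoc_natural3: "X \<in> Obj K \<Longrightarrow> Y \<in> Obj K \<Longrightarrow> central_natural_iso K S
      (\<lambda>Z. Tens S (Tens S (X, Y), Z)) (\<lambda>f. lwh K S (Tens S (X, Y)) f)
      (\<lambda>Z. Tens S (X, Tens S (Y, Z))) (\<lambda>f. lwh K S X (lwh K S Y f))
      (\<lambda>Z. Assoc S X Y Z)"
    and LUnit_natural: "central_natural_iso K S
      (\<lambda>X. Tens S (X, Unit S)) (\<lambda>f. rwh K S f (Unit S)) (\<lambda>X. X) (\<lambda>f. f) (LUnit S)"
    and RUnit_natural: "central_natural_iso K S
      (\<lambda>X. Tens S (Unit S, X)) (\<lambda>f. lwh K S (Unit S) f) (\<lambda>X. X) (\<lambda>f. f) (RUnit S)"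
    and Swap_natural1: "Y \<in> Obj K \<Longrightarrow> central_natural_iso K S
      (\<lambda>X. Tens S (X, Y)) (\<lambda>f. rwh K S f Y) (\<lambda>X. Tens S (Y, X)) (\<lambda>f. lwh K S Y f)
      (\<lambda>X. Swap S X Y)"
    and Swap_natural2: "X \<in> Obj K \<Longrightarrow> central_natural_iso K S
      (\<lambda>Y. Tens S (X, Y)) (\<lambda>f. lwh K S X f) (\<lambda>Y. Tens S (Y, X)) (\<lambda>f. rwh K S f X)
      (\<lambda>Y. Swap S X Y)"
    and pentagon: "W \<in> Obj K \<Longrightarrow> X \<in> Obj K \<Longrightarrow> Y \<in> Obj K \<Longrightarrow> Z \<in> Obj K \<Longrightarrow>
      Assoc S W X (Tens S (Y, Z)) \<cdot>\<^bsub>K\<^esub> Assoc S (Tens S (W, X)) Y Z =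
      lwh K S W (Assoc S X Y Z) \<cdot>\<^bsub>K\<^esub> Assoc S W (Tens S (X, Y)) Z \<cdot>\<^bsub>K\<^esub> rwh K S (Assoc S W X Y) Z"
    and triangle: "X \<in> Obj K \<Longrightarrow> Y \<in> Obj K \<Longrightarrow>
      lwh K S X (RUnit S Y) \<cdot>\<^bsub>K\<^esub> Assoc S X (Unit S) Y = rwh K S (LUnit S X) Y"
    and unit_unit: "LUnit S (Unit S) = RUnit S (Unit S)"
    and hexagon: "X \<in> Obj K \<Longrightarrow> Y \<in> Obj K \<Longrightarrow> Z \<in> Obj K \<Longrightarrow>
      Assoc S Y Z X \<cdot>\<^bsub>K\<^esub> Swap S X (Tens S (Y, Z)) \<cdot>\<^bsub>K\<^esub> Assoc S X Y Z =
      lwh K S Y (Swap S X Z) \<cdot>\<^bsub>K\<^esub> Assoc S Y X Z \<cdot>\<^bsub>K\<^esub> rwh K S (Swap S X Y) Z"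
    and swap_swap: "X \<in> Obj K \<Longrightarrow> Y \<in> Obj K \<Longrightarrow>
      Swap S Y X \<cdot>\<^bsub>K\<^esub> Swap S X Y = Id K (Tens S (X, Y))"
    and swap_unit: "X \<in> Obj K \<Longrightarrow> RUnit S X \<cdot>\<^bsub>K\<^esub> Swap S X (Unit S) = LUnit S X"

locale symmetric_premonoidal_functor =
  A: symmetric_premonoidal A S + B: symmetric_premonoidal B T
  for A :: "('o, 'm) cat" and S :: "('o, 'm) premonoidal_data"
    and B :: "('p, 'n) cat" and T :: "('p, 'n) premonoidal_data" +
  fixes Fo :: "'o \<Rightarrow> 'p" and Fa :: "'m \<Rightarrow> 'n"
  assumes is_functor: "is_functor A B Fo Fa"
    and pres_Tens: "X \<in> Obj A \<Longrightarrow> Y \<in> Obj A \<Longrightarrow> Fo (Tens S (X, Y)) = Tens T (Fo X, Fo Y)"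
    and pres_LTens: "(f, g) \<in> Arr (prod_cat (discr A) A) \<Longrightarrow> Fa (LTens S (f, g)) = LTens T (Fa f, Fa g)"
    and pres_RTens: "(f, g) \<in> Arr (prod_cat A (discr A)) \<Longrightarrow> Fa (RTens S (f, g)) = RTens T (Fa f, Fa g)"
    and pres_Unit: "Fo (Unit S) = Unit T"
    and pres_Assoc: "X \<in> Obj A \<Longrightarrow> Y \<in> Obj A \<Longrightarrow> Z \<in> Obj A \<Longrightarrow>
      Fa (Assoc S X Y Z) = Assoc T (Fo X) (Fo Y) (Fo Z)"
    and pres_LUnit: "X \<in> Obj A \<Longrightarrow> Fa (LUnit S X) = LUnit T (Fo X)"
    and pres_RUnit: "X \<in> Obj A \<Longrightarrow> Fa (RUnit S X) = RUnit T (Fo X)"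
    and pres_Swap: "X \<in> Obj A \<Longrightarrow> Y \<in> Obj A \<Longrightarrow> Fa (Swap S X Y) = Swap T (Fo X) (Fo Y)"

locale strict_symmetric_premonoidal_functor = symmetric_premonoidal_functor +
  assumes pres_central: "central A S k \<Longrightarrow> central B T (Fa k)"

definition prod_premonoidal ::
  "('o, 'm) cat \<Rightarrow> ('o, 'm) fprod \<Rightarrow> ('o, 'm) premonoidal_data" where
  "prod_premonoidal C P =
    \<lparr>Tens = Prod P,
     LTens = restrict (prod_arr C P) (Arr (prod_cat (discr C) C)),
     RTens = restrict (prod_arr C P) (Arr (prod_cat C (discr C))),
     Unit = One P, Assoc = prod_assoc C P, LUnit = prod_l P, RUnit = prod_r P,
     Swap = prod_swap C P\<rparr>"

text \<open>\<open>J\<close> is the arrow map; the object map is the identity.\<close>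

locale freyd_category =
  finite_products C P + symmetric_premonoidal K S +
  strict_symmetric_premonoidal_functor C "prod_premonoidal C P" K S "\<lambda>X. X" J
  for C :: "('o, 'm) cat" and P :: "('o, 'm) fprod"
    and K :: "('o, 'n) cat" and S :: "('o, 'n) premonoidal_data" and J :: "'m \<Rightarrow> 'n" +
  assumes same_objects: "Obj C = Obj K"

definition seq_premonoidal ::
  "('o, 'm) cat \<Rightarrow> ('o, 'm) cat \<Rightarrow> ('o, 'm) fprod \<Rightarrow> ('m \<times> 'm \<Rightarrow> 'm) \<Rightarrow> ('m \<times> 'm \<Rightarrow> 'm)
    \<Rightarrow> ('o, 'm) premonoidal_data" where
  "seq_premonoidal K C P lsp rsp =
    \<lparr>Tens = Prod P,
     LTens = restrict (seq_left K lsp rsp) (Arr (prod_cat (discr K) K)),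
     RTens = restrict (seq_right K lsp rsp) (Arr (prod_cat K (discr K))),
     Unit = One P, Assoc = prod_assoc C P, LUnit = prod_l P, RUnit = prod_r P,
     Swap = prod_swap C P\<rparr>"

end

theory Submission
  imports Defs
begin

text \<open>Consistency is stable under composition with pure morphisms, so the universal property of
  the semi-pure products makes \<open>\<ltimes>\<close> a functor on \<open>C \<times> K\<close> and \<open>\<rtimes>\<close> a functor on \<open>K \<times> C\<close>.
  Both restrict to \<open>\<times>\<close> on pure morphisms, so \<open>v \<ltimes> f\<close> and \<open>v \<rtimes> f\<close> agree for pure \<open>v\<close>:
  pure morphisms are central. Naturality of the structural maps follows from uniqueness of
  semi-pure products, after conjugating with the map in question, and coherence is inherited from
  \<open>C\<close>. The case of \<open>C\<close> itself is obtained by viewing \<open>C \<subseteq> C\<close> as a Cartesian effect category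
  whose consistency relation is equality.\<close>

section \<open>Rewriting rules for composition in a category\<close>

context category
begin

text \<open>Recasting the hom-set axioms as conditions on \<open>Arr\<close>, \<open>Dom\<close> and
  \<open>Cod\<close> lets the simplifier compute types, with no intermediate object to
  guess.\<close>

lemma comp_Arr [simp]:
  "f \<in> Arr K \<Longrightarrow> g \<in> Arr K \<Longrightarrow> Cod K f = Dom K g \<Longrightarrow> g \<cdot>\<^bsub>K\<^esub> f \<in> Arr K"
  and Dom_comp [simp]:
  "f \<in> Arr K \<Longrightarrow> g \<in> Arr K \<Longrightarrow> Cod K f = Dom K g \<Longrightarrow> Dom K (g \<cdot>\<^bsub>K\<^esub> f) = Dom K f"
  and Cod_comp [simp]:
  "f \<in> Arr K \<Longrightarrow> g \<in> Arr K \<Longrightarrow> Cod K f = Dom K g \<Longrightarrow> Cod K (g \<cdot>\<^bsub>K\<^esub> f) = Cod K g"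
  using comp_hom [of f "Dom K f" "Cod K f" g "Cod K g"] by (auto simp: hom_def)

lemma Id_Arr [simp]: "X \<in> Obj K \<Longrightarrow> Id K X \<in> Arr K"
  and Dom_Id [simp]: "X \<in> Obj K \<Longrightarrow> Dom K (Id K X) = X"
  and Cod_Id [simp]: "X \<in> Obj K \<Longrightarrow> Cod K (Id K X) = X"
  using id_hom [of X] by (auto simp: hom_def)

lemma comp_Id_left [simp]: "f \<in> Arr K \<Longrightarrow> Cod K f = Y \<Longrightarrow> Id K Y \<cdot>\<^bsub>K\<^esub> f = f"
  and comp_Id_right [simp]: "f \<in> Arr K \<Longrightarrow> Dom K f = X \<Longrightarrow> f \<cdot>\<^bsub>K\<^esub> Id K X = f"
  by (auto intro: id_left id_right simp: hom_def)

text \<open>Fixes right-nested composites as the normal form. This is why the projection laws below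
  come with a second version in which a further arrow \<open>h\<close> follows.\<close>

lemma assoc [simp]:
  "f \<in> Arr K \<Longrightarrow> g \<in> Arr K \<Longrightarrow> h \<in> Arr K \<Longrightarrow> Cod K f = Dom K g \<Longrightarrow> Cod K g = Dom K h \<Longrightarrow>
    (h \<cdot>\<^bsub>K\<^esub> g) \<cdot>\<^bsub>K\<^esub> f = h \<cdot>\<^bsub>K\<^esub> (g \<cdot>\<^bsub>K\<^esub> f)"
  by (rule comp_assoc) (auto simp: hom_def)

lemmas obj_closed [simp] = dom_obj cod_obj

end

section \<open>Products of a wide subcategory, computed in the ambient category\<close>

locale pure_products = wide_subcategory K C + finite_products C P
  for K :: "('o, 'm) cat" and C :: "('o, 'm) cat" and P :: "('o, 'm) fprod"
begin

declare obj_eq [simp] dom_eq [simp] cod_eq [simp]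

lemma pure_Arr [simp]: "f \<in> Arr C \<Longrightarrow> f \<in> Arr K"
  using arr_sub by auto

text \<open>Moves every composite into \<open>K\<close>, so that pure and impure arrows are
  calculated with by one operation.\<close>

lemma comp_C [simp]:
  "f \<in> Arr C \<Longrightarrow> g \<in> Arr C \<Longrightarrow> Cod K f = Dom K g \<Longrightarrow> g \<cdot>\<^bsub>C\<^esub> f = g \<cdot>\<^bsub>K\<^esub> f"
  by (rule comp_eq) (auto simp: hom_def)

lemma pure_comp [simp]:
  "f \<in> Arr C \<Longrightarrow> g \<in> Arr C \<Longrightarrow> Cod K f = Dom K g \<Longrightarrow> g \<cdot>\<^bsub>K\<^esub> f \<in> Arr C"
  using C.comp_Arr [of f g] by simp

lemma Id_C [simp]: "X \<in> Obj K \<Longrightarrow> Id C X = Id K X"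
  using id_eq by simp

lemma pure_Id [simp]: "X \<in> Obj K \<Longrightarrow> Id K X \<in> Arr C"
  using C.Id_Arr [of X] by simp

lemma hom_C: "f \<in> hom C X Y \<longleftrightarrow> f \<in> Arr C \<and> Dom K f = X \<and> Cod K f = Y"
  by (auto simp: hom_def)

lemma One_obj [simp]: "One P \<in> Obj K"
  using terminal_One by (simp add: terminal_def)

lemma terminal_eq:
  "f \<in> Arr C \<Longrightarrow> g \<in> Arr C \<Longrightarrow> Dom K f = Dom K g \<Longrightarrow> Cod K f = One P \<Longrightarrow> Cod K g = One P \<Longrightarrow> f = g"
  using terminal_One by (auto simp: terminal_def hom_C dest!: bspec [of _ _ "Dom K g"])

lemma Prod_closed [simp]: "X \<in> Obj K \<Longrightarrow> Y \<in> Obj K \<Longrightarrow> Prod P (X, Y) \<in> Obj K"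
  using Prod_obj by simp

lemma Pr_pure [simp]:
  assumes "X \<in> Obj K" "Y \<in> Obj K"
  shows "Pr1 P X Y \<in> Arr C" "Dom K (Pr1 P X Y) = Prod P (X, Y)" "Cod K (Pr1 P X Y) = X"
    "Pr2 P X Y \<in> Arr C" "Dom K (Pr2 P X Y) = Prod P (X, Y)" "Cod K (Pr2 P X Y) = Y"
  using Pr1_hom [of X Y] Pr2_hom [of X Y] assms by (auto simp: hom_C)

lemma pairing_ex1:
  assumes "f \<in> Arr C" "g \<in> Arr C" "Dom K f = Dom K g"
  shows "\<exists>!h. h \<in> hom C (Dom K f) (Prod P (Cod K f, Cod K g)) \<and>
    Pr1 P (Cod K f) (Cod K g) \<cdot>\<^bsub>C\<^esub> h = f \<and> Pr2 P (Cod K f) (Cod K g) \<cdot>\<^bsub>C\<^esub> h = g"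
  by (rule pairing_unique) (use assms in \<open>auto simp: hom_C\<close>)

lemma pairing_char:
  assumes "f \<in> Arr C" "g \<in> Arr C" "Dom K f = Dom K g"
  shows "pairing C P f g \<in> hom C (Dom K f) (Prod P (Cod K f, Cod K g)) \<and>
    Pr1 P (Cod K f) (Cod K g) \<cdot>\<^bsub>C\<^esub> pairing C P f g = f \<and>
    Pr2 P (Cod K f) (Cod K g) \<cdot>\<^bsub>C\<^esub> pairing C P f g = g"
  using theI' [OF pairing_ex1 [OF assms]] assms by (simp add: pairing_def)

lemma pairing_pure [simp]:
  assumes "f \<in> Arr C" "g \<in> Arr C" "Dom K f = Dom K g"
  shows "pairing C P f g \<in> Arr C" "Dom K (pairing C P f g) = Dom K g"
    "Cod K (pairing C P f g) = Prod P (Cod K f, Cod K g)"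
  using pairing_char [OF assms] assms by (auto simp: hom_C)

lemma Pr_pairing [simp]:
  assumes "f \<in> Arr C" "g \<in> Arr C" "Dom K f = Dom K g" "Cod K f = X" "Cod K g = Y"
  shows "Pr1 P X Y \<cdot>\<^bsub>K\<^esub> pairing C P f g = f" "Pr2 P X Y \<cdot>\<^bsub>K\<^esub> pairing C P f g = g"
  using pairing_char [OF assms(1-3)] assms by auto

text \<open>In right-nested form the projection is no longer adjacent to the pairing alone, so
  \<open>Pr_pairing\<close> itself does not match.\<close>

lemma Pr_pairing_comp [simp]:
  assumes "f \<in> Arr C" "g \<in> Arr C" "Dom K f = Dom K g" "Cod K f = X" "Cod K g = Y"
    and "h \<in> Arr K" "Cod K h = Dom K g"
  shows "Pr1 P X Y \<cdot>\<^bsub>K\<^esub> pairing C P f g \<cdot>\<^bsub>K\<^esub> h = f \<cdot>\<^bsub>K\<^esub> h"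
    "Pr2 P X Y \<cdot>\<^bsub>K\<^esub> pairing C P f g \<cdot>\<^bsub>K\<^esub> h = g \<cdot>\<^bsub>K\<^esub> h"
proof -
  have "Pr1 P X Y \<cdot>\<^bsub>K\<^esub> pairing C P f g \<cdot>\<^bsub>K\<^esub> h = (Pr1 P X Y \<cdot>\<^bsub>K\<^esub> pairing C P f g) \<cdot>\<^bsub>K\<^esub> h"
    "Pr2 P X Y \<cdot>\<^bsub>K\<^esub> pairing C P f g \<cdot>\<^bsub>K\<^esub> h = (Pr2 P X Y \<cdot>\<^bsub>K\<^esub> pairing C P f g) \<cdot>\<^bsub>K\<^esub> h"
    using assms by (auto simp del: Pr_pairing)
  then show "Pr1 P X Y \<cdot>\<^bsub>K\<^esub> pairing C P f g \<cdot>\<^bsub>K\<^esub> h = f \<cdot>\<^bsub>K\<^esub> h"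
    "Pr2 P X Y \<cdot>\<^bsub>K\<^esub> pairing C P f g \<cdot>\<^bsub>K\<^esub> h = g \<cdot>\<^bsub>K\<^esub> h"
    using assms by simp_all
qed

text \<open>The uniqueness half of the universal property; the types of \<open>f\<close> and
  \<open>g\<close> are recovered from the two equations.\<close>

lemma pairing_eqI:
  assumes "h \<in> Arr C" "Cod K h = Prod P (X, Y)" "X \<in> Obj K" "Y \<in> Obj K"
    and "Pr1 P X Y \<cdot>\<^bsub>K\<^esub> h = f" "Pr2 P X Y \<cdot>\<^bsub>K\<^esub> h = g"
  shows "h = pairing C P f g"
proof -
  have fg: "f \<in> Arr C" "g \<in> Arr C" "Dom K f = Dom K h" "Dom K g = Dom K h" "Cod K f = X" "Cod K g = Y"
    using assms by auto
  have dom: "Dom K f = Dom K g" using fg by simp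
  have "h \<in> hom C (Dom K f) (Prod P (Cod K f, Cod K g)) \<and>
    Pr1 P (Cod K f) (Cod K g) \<cdot>\<^bsub>C\<^esub> h = f \<and> Pr2 P (Cod K f) (Cod K g) \<cdot>\<^bsub>C\<^esub> h = g"
    using assms fg by (simp add: hom_C)
  then show ?thesis
    using pairing_char [OF fg(1,2) dom] pairing_ex1 [OF fg(1,2) dom] by blast
qed

text \<open>With \<open>pairing_Pr\<close> and \<open>pairing_Pr_comp\<close> this normalises pure
  maps between products, so that inverse laws and coherence equations can be proved by
  simplification. Purity of \<open>h\<close> keeps the right-hand side a pairing in
  \<open>C\<close>.\<close>

lemma pairing_comp [simp]:
  assumes "f \<in> Arr C" "g \<in> Arr C" "Dom K f = Dom K g" "h \<in> Arr C" "Cod K h = Dom K g"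
  shows "pairing C P f g \<cdot>\<^bsub>K\<^esub> h = pairing C P (f \<cdot>\<^bsub>K\<^esub> h) (g \<cdot>\<^bsub>K\<^esub> h)"
  by (rule pairing_eqI [of _ "Cod K f" "Cod K g"]) (use assms in auto)

lemma pairing_Pr [simp]:
  "X \<in> Obj K \<Longrightarrow> Y \<in> Obj K \<Longrightarrow> pairing C P (Pr1 P X Y) (Pr2 P X Y) = Id K (Prod P (X, Y))"
  by (rule pairing_eqI [of _ X Y, symmetric]) auto

lemma pairing_Pr_comp [simp]:
  "X \<in> Obj K \<Longrightarrow> Y \<in> Obj K \<Longrightarrow> h \<in> Arr C \<Longrightarrow> Cod K h = Prod P (X, Y) \<Longrightarrow>
    pairing C P (Pr1 P X Y \<cdot>\<^bsub>K\<^esub> h) (Pr2 P X Y \<cdot>\<^bsub>K\<^esub> h) = h"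
  by (rule pairing_eqI [of _ X Y, symmetric]) auto

lemma prod_arr_eq:
  "f \<in> Arr C \<Longrightarrow> g \<in> Arr C \<Longrightarrow> prod_arr C P (f, g) =
    pairing C P (f \<cdot>\<^bsub>K\<^esub> Pr1 P (Dom K f) (Dom K g)) (g \<cdot>\<^bsub>K\<^esub> Pr2 P (Dom K f) (Dom K g))"
  by (simp add: prod_arr_def)

lemma prod_arr_hom:
  "f \<in> Arr C \<Longrightarrow> g \<in> Arr C \<Longrightarrow>
    prod_arr C P (f, g) \<in> hom C (Prod P (Dom C f, Dom C g)) (Prod P (Cod C f, Cod C g))"
  by (simp add: prod_arr_eq hom_C)

text \<open>Shaped like the axioms of the semi-pure products with consistency replaced by equality,
  for the case where \<open>C\<close> plays the role of \<open>K\<close>.\<close>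

lemma prod_arr_unique:
  assumes "f \<in> hom C X1 Y1" "g \<in> hom C X2 Y2" "h \<in> hom C (Prod P (X1, X2)) (Prod P (Y1, Y2))"
  shows "Pr1 P Y1 Y2 \<cdot>\<^bsub>K\<^esub> h = f \<cdot>\<^bsub>K\<^esub> Pr1 P X1 X2 \<and> Pr2 P Y1 Y2 \<cdot>\<^bsub>K\<^esub> h = g \<cdot>\<^bsub>K\<^esub> Pr2 P X1 X2 \<longleftrightarrow>
    h = prod_arr C P (f, g)"
proof -
  have "X1 \<in> Obj K" "Y1 \<in> Obj K" "X2 \<in> Obj K" "Y2 \<in> Obj K"
    using assms by (auto simp: hom_C)
  then show ?thesis
    using assms pairing_eqI [of h Y1 Y2] by (auto simp: hom_C prod_arr_eq)
qed


section \<open>Structural isomorphisms of the products and their inverses\<close>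

definition assoc_inv :: "'o \<Rightarrow> 'o \<Rightarrow> 'o \<Rightarrow> 'm" where
  "assoc_inv X Y Z =
    pairing C P
      (pairing C P (Pr1 P X (Prod P (Y, Z))) (Pr1 P Y Z \<cdot>\<^bsub>K\<^esub> Pr2 P X (Prod P (Y, Z))))
      (Pr2 P Y Z \<cdot>\<^bsub>K\<^esub> Pr2 P X (Prod P (Y, Z)))"

lemma prod_assoc_eq:
  "X \<in> Obj K \<Longrightarrow> Y \<in> Obj K \<Longrightarrow> Z \<in> Obj K \<Longrightarrow> prod_assoc C P X Y Z =
    pairing C P (Pr1 P X Y \<cdot>\<^bsub>K\<^esub> Pr1 P (Prod P (X, Y)) Z)
      (pairing C P (Pr2 P X Y \<cdot>\<^bsub>K\<^esub> Pr1 P (Prod P (X, Y)) Z) (Pr2 P (Prod P (X, Y)) Z))"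
  by (simp add: prod_assoc_def)

lemma assoc_typing [simp]:
  assumes "X \<in> Obj K" "Y \<in> Obj K" "Z \<in> Obj K"
  shows "prod_assoc C P X Y Z \<in> Arr C"
    "Dom K (prod_assoc C P X Y Z) = Prod P (Prod P (X, Y), Z)"
    "Cod K (prod_assoc C P X Y Z) = Prod P (X, Prod P (Y, Z))"
    "assoc_inv X Y Z \<in> Arr C"
    "Dom K (assoc_inv X Y Z) = Prod P (X, Prod P (Y, Z))"
    "Cod K (assoc_inv X Y Z) = Prod P (Prod P (X, Y), Z)"
  using assms by (simp_all add: prod_assoc_eq assoc_inv_def)

lemma assoc_inverse:
  assumes "X \<in> Obj K" "Y \<in> Obj K" "Z \<in> Obj K"
  shows "assoc_inv X Y Z \<cdot>\<^bsub>K\<^esub> prod_assoc C P X Y Z = Id K (Prod P (Prod P (X, Y), Z))"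
    "prod_assoc C P X Y Z \<cdot>\<^bsub>K\<^esub> assoc_inv X Y Z = Id K (Prod P (X, Prod P (Y, Z)))"
  using assms by (simp_all add: prod_assoc_eq assoc_inv_def)

lemma swap_typing [simp]:
  assumes "X \<in> Obj K" "Y \<in> Obj K"
  shows "prod_swap C P X Y \<in> Arr C" "Dom K (prod_swap C P X Y) = Prod P (X, Y)"
    "Cod K (prod_swap C P X Y) = Prod P (Y, X)"
  using assms by (simp_all add: prod_swap_def)

lemma swap_inverse:
  assumes "X \<in> Obj K" "Y \<in> Obj K"
  shows "prod_swap C P Y X \<cdot>\<^bsub>K\<^esub> prod_swap C P X Y = Id K (Prod P (X, Y))"
  using assms by (simp add: prod_swap_def)

lemma unit_typing [simp]:
  assumes "X \<in> Obj K"
  shows "prod_l P X \<in> Arr C" "Dom K (prod_l P X) = Prod P (X, One P)" "Cod K (prod_l P X) = X"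
    "prod_r P X \<in> Arr C" "Dom K (prod_r P X) = Prod P (One P, X)" "Cod K (prod_r P X) = X"
  using assms by (simp_all add: prod_l_def prod_r_def)

end


section \<open>Discrete categories, product categories, composite functors\<close>

lemma category_discr:
  assumes "category K"
  shows "category (discr K)"
proof -
  interpret category K by fact
  show ?thesis by unfold_locales (auto simp: discr_def hom_def)
qed

lemma category_prod_cat:
  assumes "category A" "category B"
  shows "category (prod_cat A B)"
proof -
  interpret A: category A by fact
  interpret B: category B by fact
  show ?thesis by unfold_locales (auto simp: prod_cat_def hom_def)
qed

lemma is_functor_comp:
  assumes "is_functor A B Fo Fa" "is_functor B D Go Ga"
  shows "is_functor A D (\<lambda>X. Go (Fo X)) (\<lambda>f. Ga (Fa f))"
proof -
  have "Fa f \<in> hom B (Fo X) (Fo Y)" if "f \<in> hom A X Y" for f X Y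
    using assms that by (auto simp: is_functor_def graph_hom_def hom_def)
  then show ?thesis
    using assms unfolding is_functor_def graph_hom_def hom_def by fastforce
qed

section \<open>Consistency, semi-pure and sequential products\<close>

context cartesian_effect_category
begin

sublocale pure_products K C P ..

text \<open>The composition axiom with objects eliminated: \<open>cns_typed\<close> yields the types
  of \<open>v\<close> and \<open>g\<close>, so only the connecting arrow \<open>u\<close> has to be
  named in applications.\<close>

lemma cns_comp_Arr:
  assumes "cns (u \<cdot>\<^bsub>K\<^esub> f) v" "cns g (w \<cdot>\<^bsub>K\<^esub> u)"
    and "f \<in> Arr K" "Cod K f = Dom K g" "u \<in> Arr C" "Dom K u = Dom K g"
    and "w \<in> Arr C" "Dom K w = Cod K u"
  shows "cns (g \<cdot>\<^bsub>K\<^esub> f) (w \<cdot>\<^bsub>K\<^esub> v)"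
proof (rule cns_comp [OF _ _ _ _ _ assms(1,2)])
  have "v \<in> Arr C" "Dom K v = Dom K f" "Cod K v = Cod K u"
    using cns_typed [OF assms(1)] assms(3-6) by simp_all
  then show "v \<in> hom C (Dom K f) (Cod K u)"
    by (simp add: hom_C)
  have "g \<in> Arr K" "Cod K g = Cod K w"
    using cns_typed [OF assms(2)] assms(5,7,8) by simp_all
  then show "g \<in> hom K (Dom K g) (Cod K w)"
    by (simp add: hom_def)
  show "f \<in> hom K (Dom K f) (Dom K g)"
    using assms(3,4) by (simp add: hom_def)
  show "u \<in> hom C (Dom K g) (Cod K u)" "w \<in> hom C (Cod K u) (Cod K w)"
    using assms(5-8) by (simp_all add: hom_C)
qed

text \<open>The composition axiom with an identity as connecting arrow, the second premise being
  \<open>w \<lhd> w\<close>. In \<open>cns_comp_pure\<close> reflexivity supplies the first premise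
  instead.\<close>

lemma cns_pure_comp:
  assumes "cns f v" "w \<in> Arr C" "Dom K w = Cod K f"
  shows "cns (w \<cdot>\<^bsub>K\<^esub> f) (w \<cdot>\<^bsub>K\<^esub> v)"
proof -
  have "f \<in> Arr K" using cns_typed [OF assms(1)] by simp
  then show ?thesis
    by (intro cns_comp_Arr [where u = "Id K (Cod K f)"])
      (use assms in \<open>simp_all add: cns_refl\<close>)
qed

lemma cns_comp_pure:
  assumes "cns f v" "u \<in> Arr C" "Cod K u = Dom K f"
  shows "cns (f \<cdot>\<^bsub>K\<^esub> u) (v \<cdot>\<^bsub>K\<^esub> u)"
proof -
  have "f \<in> Arr K" "v \<in> Arr C" "Dom K v = Dom K f" using cns_typed [OF assms(1)] by simp_all
  then show ?thesis
    by (intro cns_comp_Arr [where u = "Id K (Dom K f)"])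
      (use assms in \<open>simp_all add: cns_refl\<close>)
qed

lemma lsp_typing [simp]:
  assumes "v \<in> Arr C" "f \<in> Arr K"
  shows "lsp (v, f) \<in> Arr K" "Dom K (lsp (v, f)) = Prod P (Dom K v, Dom K f)"
    "Cod K (lsp (v, f)) = Prod P (Cod K v, Cod K f)"
proof -
  have "lsp (v, f) \<in> hom K (Prod P (Dom K v, Dom K f)) (Prod P (Cod K v, Cod K f))"
    using lsp_graph_hom assms by (auto simp: graph_hom_def prod_cat_def dest!: bspec [of _ _ "(v, f)"])
  then show "lsp (v, f) \<in> Arr K" "Dom K (lsp (v, f)) = Prod P (Dom K v, Dom K f)"
    "Cod K (lsp (v, f)) = Prod P (Cod K v, Cod K f)"
    by (simp_all add: hom_def)
qed

lemma rsp_typing [simp]: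
  assumes "f \<in> Arr K" "v \<in> Arr C"
  shows "rsp (f, v) \<in> Arr K" "Dom K (rsp (f, v)) = Prod P (Dom K f, Dom K v)"
    "Cod K (rsp (f, v)) = Prod P (Cod K f, Cod K v)"
proof -
  have "rsp (f, v) \<in> hom K (Prod P (Dom K f, Dom K v)) (Prod P (Cod K f, Cod K v))"
    using rsp_graph_hom assms by (auto simp: graph_hom_def prod_cat_def dest!: bspec [of _ _ "(f, v)"])
  then show "rsp (f, v) \<in> Arr K" "Dom K (rsp (f, v)) = Prod P (Dom K f, Dom K v)"
    "Cod K (rsp (f, v)) = Prod P (Cod K f, Cod K v)"
    by (simp_all add: hom_def)
qed

text \<open>Used in both directions: at \<open>h = lsp (v, f)\<close> it yields the two projection
  laws, and from right to left it identifies an arrow as a semi-pure product.\<close>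

lemma lsp_iff:
  assumes "v \<in> Arr C" "f \<in> Arr K" "h \<in> Arr K" "Dom K h = Prod P (Dom K v, Dom K f)"
    "Cod K h = Prod P (Cod K v, Cod K f)"
  shows "h = lsp (v, f) \<longleftrightarrow>
    cns (Pr1 P (Cod K v) (Cod K f) \<cdot>\<^bsub>K\<^esub> h) (v \<cdot>\<^bsub>K\<^esub> Pr1 P (Dom K v) (Dom K f)) \<and>
    Pr2 P (Cod K v) (Cod K f) \<cdot>\<^bsub>K\<^esub> h = f \<cdot>\<^bsub>K\<^esub> Pr2 P (Dom K v) (Dom K f)"
  by (rule lsp_unique [symmetric]) (use assms in \<open>simp_all add: hom_C\<close>, simp_all add: hom_def)

lemma rsp_iff:
  assumes "f \<in> Arr K" "v \<in> Arr C" "h \<in> Arr K" "Dom K h = Prod P (Dom K f, Dom K v)"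
    "Cod K h = Prod P (Cod K f, Cod K v)"
  shows "h = rsp (f, v) \<longleftrightarrow>
    Pr1 P (Cod K f) (Cod K v) \<cdot>\<^bsub>K\<^esub> h = f \<cdot>\<^bsub>K\<^esub> Pr1 P (Dom K f) (Dom K v) \<and>
    cns (Pr2 P (Cod K f) (Cod K v) \<cdot>\<^bsub>K\<^esub> h) (v \<cdot>\<^bsub>K\<^esub> Pr2 P (Dom K f) (Dom K v))"
  by (rule rsp_unique [symmetric]) (use assms in \<open>simp_all add: hom_C\<close>, simp_all add: hom_def)

lemma lsp_cns:
  assumes "v \<in> Arr C" "f \<in> Arr K" "Cod K v = Y1" "Cod K f = Y2"
  shows "cns (Pr1 P Y1 Y2 \<cdot>\<^bsub>K\<^esub> lsp (v, f)) (v \<cdot>\<^bsub>K\<^esub> Pr1 P (Dom K v) (Dom K f))"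
  using lsp_iff [of v f "lsp (v, f)"] assms by simp

lemma lsp_Pr2 [simp]:
  assumes "v \<in> Arr C" "f \<in> Arr K" "Cod K v = Y1" "Cod K f = Y2"
  shows "Pr2 P Y1 Y2 \<cdot>\<^bsub>K\<^esub> lsp (v, f) = f \<cdot>\<^bsub>K\<^esub> Pr2 P (Dom K v) (Dom K f)"
  using lsp_iff [of v f "lsp (v, f)"] assms by simp

lemma rsp_cns:
  assumes "f \<in> Arr K" "v \<in> Arr C" "Cod K f = Y1" "Cod K v = Y2"
  shows "cns (Pr2 P Y1 Y2 \<cdot>\<^bsub>K\<^esub> rsp (f, v)) (v \<cdot>\<^bsub>K\<^esub> Pr2 P (Dom K f) (Dom K v))"
  using rsp_iff [of f v "rsp (f, v)"] assms by simp

lemma rsp_Pr1 [simp]: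
  assumes "f \<in> Arr K" "v \<in> Arr C" "Cod K f = Y1" "Cod K v = Y2"
  shows "Pr1 P Y1 Y2 \<cdot>\<^bsub>K\<^esub> rsp (f, v) = f \<cdot>\<^bsub>K\<^esub> Pr1 P (Dom K f) (Dom K v)"
  using rsp_iff [of f v "rsp (f, v)"] assms by simp

lemma lsp_Pr2_comp [simp]:
  assumes "v \<in> Arr C" "f \<in> Arr K" "Cod K v = Y1" "Cod K f = Y2"
    and "h \<in> Arr K" "Cod K h = Prod P (Dom K v, Dom K f)"
  shows "Pr2 P Y1 Y2 \<cdot>\<^bsub>K\<^esub> lsp (v, f) \<cdot>\<^bsub>K\<^esub> h = f \<cdot>\<^bsub>K\<^esub> Pr2 P (Dom K v) (Dom K f) \<cdot>\<^bsub>K\<^esub> h"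
proof -
  have "Pr2 P Y1 Y2 \<cdot>\<^bsub>K\<^esub> lsp (v, f) \<cdot>\<^bsub>K\<^esub> h = (Pr2 P Y1 Y2 \<cdot>\<^bsub>K\<^esub> lsp (v, f)) \<cdot>\<^bsub>K\<^esub> h"
    using assms by (auto simp del: lsp_Pr2)
  then show ?thesis using assms by auto
qed

lemma rsp_Pr1_comp [simp]:
  assumes "f \<in> Arr K" "v \<in> Arr C" "Cod K f = Y1" "Cod K v = Y2"
    and "h \<in> Arr K" "Cod K h = Prod P (Dom K f, Dom K v)"
  shows "Pr1 P Y1 Y2 \<cdot>\<^bsub>K\<^esub> rsp (f, v) \<cdot>\<^bsub>K\<^esub> h = f \<cdot>\<^bsub>K\<^esub> Pr1 P (Dom K f) (Dom K v) \<cdot>\<^bsub>K\<^esub> h"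
proof -
  have "Pr1 P Y1 Y2 \<cdot>\<^bsub>K\<^esub> rsp (f, v) \<cdot>\<^bsub>K\<^esub> h = (Pr1 P Y1 Y2 \<cdot>\<^bsub>K\<^esub> rsp (f, v)) \<cdot>\<^bsub>K\<^esub> h"
    using assms by (auto simp del: rsp_Pr1)
  then show ?thesis using assms by auto
qed

text \<open>Both semi-pure products extend \<open>\<times>\<close>. Centrality of pure arrows rests
  on this bridge between them.\<close>

lemma lsp_eq_rsp: "v \<in> Arr C \<Longrightarrow> w \<in> Arr C \<Longrightarrow> lsp (v, w) = rsp (v, w)"
  by (simp add: lsp_pure rsp_pure)

text \<open>The composite meets the conditions that characterise the right-hand side: the second
  projection by chaining two equations, the first by the composition axiom for consistency.\<close>

lemma lsp_comp:
  assumes "v \<in> Arr C" "w \<in> Arr C" "Cod K v = Dom K w" "f \<in> Arr K" "g \<in> Arr K" "Cod K f = Dom K g"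
  shows "lsp (w, g) \<cdot>\<^bsub>K\<^esub> lsp (v, f) = lsp (w \<cdot>\<^bsub>K\<^esub> v, g \<cdot>\<^bsub>K\<^esub> f)"
proof -
  \<comment> \<open>The connecting arrow is the first projection of the middle product:
    \<open>lsp (v, f)\<close> followed by it is consistent with \<open>v\<close> after a projection,
    and it followed by \<open>w\<close> is what the first projection of \<open>lsp (w, g)\<close> is
    consistent with.\<close>
  have "cns ((Pr1 P (Cod K w) (Cod K g) \<cdot>\<^bsub>K\<^esub> lsp (w, g)) \<cdot>\<^bsub>K\<^esub> lsp (v, f))
    (w \<cdot>\<^bsub>K\<^esub> v \<cdot>\<^bsub>K\<^esub> Pr1 P (Dom K v) (Dom K f))"
    by (rule cns_comp_Arr [where u = "Pr1 P (Dom K w) (Dom K g)"])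
      (use assms in \<open>auto intro: lsp_cns\<close>)
  then show ?thesis
    using assms by (subst lsp_iff) auto
qed

lemma rsp_comp:
  assumes "f \<in> Arr K" "g \<in> Arr K" "Cod K f = Dom K g" "v \<in> Arr C" "w \<in> Arr C" "Cod K v = Dom K w"
  shows "rsp (g, w) \<cdot>\<^bsub>K\<^esub> rsp (f, v) = rsp (g \<cdot>\<^bsub>K\<^esub> f, w \<cdot>\<^bsub>K\<^esub> v)"
proof -
  have "cns ((Pr2 P (Cod K g) (Cod K w) \<cdot>\<^bsub>K\<^esub> rsp (g, w)) \<cdot>\<^bsub>K\<^esub> rsp (f, v))
    (w \<cdot>\<^bsub>K\<^esub> v \<cdot>\<^bsub>K\<^esub> Pr2 P (Dom K f) (Dom K v))"
    by (rule cns_comp_Arr [where u = "Pr2 P (Dom K g) (Dom K w)"])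
      (use assms in \<open>auto intro: rsp_cns\<close>)
  then show ?thesis
    using assms by (subst rsp_iff) auto
qed

lemma sp_Id [simp]:
  assumes "X \<in> Obj K" "Y \<in> Obj K"
  shows "lsp (Id K X, Id K Y) = Id K (Prod P (X, Y))" "rsp (Id K X, Id K Y) = Id K (Prod P (X, Y))"
  using assms by (simp_all add: lsp_pure rsp_pure prod_arr_eq)

text \<open>For pure \<open>v\<close> the factor \<open>rsp (v, Id)\<close> is also
  \<open>lsp (v, Id)\<close>, so \<open>lsp_comp\<close> merges the two factors. The next three
  rules use the same argument or its mirror image.\<close>

lemma seq_left_lsp [simp]:
  "v \<in> Arr C \<Longrightarrow> f \<in> Arr K \<Longrightarrow> seq_left K lsp rsp (v, f) = lsp (v, f)"
  by (simp add: seq_left_def lsp_eq_rsp [symmetric] lsp_comp)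

lemma seq_left_rsp [simp]:
  "f \<in> Arr K \<Longrightarrow> v \<in> Arr C \<Longrightarrow> seq_left K lsp rsp (f, v) = rsp (f, v)"
  by (simp add: seq_left_def lsp_eq_rsp rsp_comp)

lemma seq_right_rsp [simp]:
  "f \<in> Arr K \<Longrightarrow> v \<in> Arr C \<Longrightarrow> seq_right K lsp rsp (f, v) = rsp (f, v)"
  by (simp add: seq_right_def lsp_eq_rsp rsp_comp)

lemma seq_right_lsp [simp]:
  "v \<in> Arr C \<Longrightarrow> f \<in> Arr K \<Longrightarrow> seq_right K lsp rsp (v, f) = lsp (v, f)"
  by (simp add: seq_right_def lsp_eq_rsp [symmetric] lsp_comp)

section \<open>Binoidal structure and centrality of pure arrows\<close>

abbreviation S :: "('o, 'm) premonoidal_data" where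
  "S \<equiv> seq_premonoidal K C P lsp rsp"

text \<open>The pair lies in the domain of the restriction, and since identities are pure the
  sequential product collapses to a semi-pure one.\<close>

lemma LTens_eq [simp]: "X \<in> Obj K \<Longrightarrow> f \<in> Arr K \<Longrightarrow> LTens S (Id K X, f) = lsp (Id K X, f)"
  by (simp add: seq_premonoidal_def prod_cat_def discr_def)

lemma RTens_eq [simp]: "X \<in> Obj K \<Longrightarrow> f \<in> Arr K \<Longrightarrow> RTens S (f, Id K X) = rsp (f, Id K X)"
  by (simp add: seq_premonoidal_def prod_cat_def discr_def)

lemma lwh_eq [simp]: "X \<in> Obj K \<Longrightarrow> f \<in> Arr K \<Longrightarrow> lwh K S X f = lsp (Id K X, f)"
  and rwh_eq [simp]: "X \<in> Obj K \<Longrightarrow> f \<in> Arr K \<Longrightarrow> rwh K S f X = rsp (f, Id K X)"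
  by (simp_all add: lwh_def rwh_def)

lemma S_simps [simp]:
  "Tens S = Prod P" "Unit S = One P" "Assoc S = prod_assoc C P" "LUnit S = prod_l P"
  "RUnit S = prod_r P" "Swap S = prod_swap C P"
  by (simp_all add: seq_premonoidal_def)

text \<open>Tensoring with an identity is a semi-pure product, so both sides unfold to the same
  composite. Besides being a claim of the theorem, this expresses centrality through sequential
  products.\<close>

lemma fr_eq:
  assumes "f \<in> Arr K" "g \<in> Arr K"
  shows "fr_left K S (f, g) = seq_left K lsp rsp (f, g)"
    "fr_right K S (f, g) = seq_right K lsp rsp (f, g)"
  using assms by (simp_all add: fr_left_def fr_right_def seq_left_def seq_right_def)

text \<open>\<open>seq_left\<close> and \<open>seq_right\<close> both reduce to \<open>lsp\<close>
  if the first argument is pure and both to \<open>rsp\<close> if the second one is.\<close>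

lemma pure_central: "v \<in> Arr C \<Longrightarrow> central K S v"
  by (simp add: central_def fr_eq)

lemma binoidal: "binoidal K S"
proof
  have "category (prod_cat (discr K) K)" "category (prod_cat K (discr K))"
    by (simp_all add: category_prod_cat category_discr K.category_axioms)
  then show "is_functor (prod_cat (discr K) K) K (Tens S) (LTens S)"
    "is_functor (prod_cat K (discr K)) K (Tens S) (RTens S)"
    using K.category_axioms
    by (auto simp: is_functor_def graph_hom_def prod_cat_def discr_def hom_def lsp_comp rsp_comp)
  show "LTens S (f, g) = RTens S (f, g)" if "f \<in> Arr (discr K)" "g \<in> Arr (discr K)" for f g
    using that by (auto simp: discr_def)
qed

section \<open>Whiskering functors and naturality of the structural maps\<close>

lemma Id_functor: "is_functor K K (\<lambda>X. X) (\<lambda>f. f)"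
  using K.category_axioms by (auto simp: is_functor_def graph_hom_def hom_def)

lemma lwh_functor: "X \<in> Obj K \<Longrightarrow> is_functor K K (\<lambda>Y. Prod P (X, Y)) (\<lambda>f. lwh K S X f)"
  using K.category_axioms
  by (auto simp: is_functor_def graph_hom_def hom_def lsp_comp)

lemma rwh_functor: "Y \<in> Obj K \<Longrightarrow> is_functor K K (\<lambda>X. Prod P (X, Y)) (\<lambda>f. rwh K S f Y)"
  using K.category_axioms
  by (auto simp: is_functor_def graph_hom_def hom_def rsp_comp)

text \<open>Centrality comes from purity of the components; what remains is functoriality, a family
  \<open>u\<close> of inverses, and the naturality squares.\<close>

lemma central_natural_isoI:
  assumes "is_functor K K Fo Fa" "is_functor K K Go Ga"
    and "\<And>X. X \<in> Obj K \<Longrightarrow> t X \<in> Arr C \<and> Dom K (t X) = Fo X \<and> Cod K (t X) = Go X"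
    and "\<And>X. X \<in> Obj K \<Longrightarrow> u X \<in> Arr K \<and> Dom K (u X) = Go X \<and> Cod K (u X) = Fo X"
    and "\<And>X. X \<in> Obj K \<Longrightarrow> u X \<cdot>\<^bsub>K\<^esub> t X = Id K (Fo X) \<and> t X \<cdot>\<^bsub>K\<^esub> u X = Id K (Go X)"
    and "\<And>f. f \<in> Arr K \<Longrightarrow> t (Cod K f) \<cdot>\<^bsub>K\<^esub> Fa f = Ga f \<cdot>\<^bsub>K\<^esub> t (Dom K f)"
  shows "central_natural_iso K S Fo Fa Go Ga t"
  using assms
  by (auto simp: central_natural_iso_def natural_trans_def is_iso_def pure_central hom_def)

text \<open>Projections that are again products are written with \<open>rsp\<close> or
  \<open>lsp\<close>, so that \<open>rsp_comp\<close> and \<open>lsp_comp\<close> can slide them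
  past impure arrows.\<close>

lemma assoc_Pr:
  assumes "X \<in> Obj K" "Y \<in> Obj K" "Z \<in> Obj K"
  shows "Pr1 P (Prod P (X, Y)) Z \<cdot>\<^bsub>K\<^esub> assoc_inv X Y Z = rsp (Id K X, Pr1 P Y Z)"
    "Pr2 P (Prod P (X, Y)) Z \<cdot>\<^bsub>K\<^esub> assoc_inv X Y Z = Pr2 P Y Z \<cdot>\<^bsub>K\<^esub> Pr2 P X (Prod P (Y, Z))"
    "Pr1 P X (Prod P (Y, Z)) \<cdot>\<^bsub>K\<^esub> prod_assoc C P X Y Z = Pr1 P X Y \<cdot>\<^bsub>K\<^esub> Pr1 P (Prod P (X, Y)) Z"
    "Pr2 P X (Prod P (Y, Z)) \<cdot>\<^bsub>K\<^esub> prod_assoc C P X Y Z = lsp (Pr2 P X Y, Id K Z)"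
    "rsp (Id K X, Pr1 P Y Z) \<cdot>\<^bsub>K\<^esub> prod_assoc C P X Y Z = Pr1 P (Prod P (X, Y)) Z"
    "lsp (Pr2 P X Y, Id K Z) \<cdot>\<^bsub>K\<^esub> assoc_inv X Y Z = Pr2 P X (Prod P (Y, Z))"
  using assms by (simp_all add: lsp_pure rsp_pure prod_arr_eq prod_assoc_eq assoc_inv_def)

text \<open>Conjugating the unnested product \<open>?F\<close> and recognising the result as the
  nested one leaves a consistency condition for a map into \<open>Z\<close> only. Projecting
  consistency out of a product is immediate from the composition axiom; pairing two consistency
  statements is not.\<close>

lemma assoc_natural1:
  assumes f: "f \<in> Arr K" "Dom K f = X" "Cod K f = X'" and Y: "Y \<in> Obj K" and Z: "Z \<in> Obj K"
  shows "prod_assoc C P X' Y Z \<cdot>\<^bsub>K\<^esub> rsp (rsp (f, Id K Y), Id K Z) =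
    rsp (f, Id K (Prod P (Y, Z))) \<cdot>\<^bsub>K\<^esub> prod_assoc C P X Y Z"
proof -
  have obj [simp]: "X \<in> Obj K" "X' \<in> Obj K" using f by auto
  note typing [simp] = f Y Z
  let ?F = "rsp (f, Id K (Prod P (Y, Z)))" and ?\<alpha> = "prod_assoc C P X Y Z"
  let ?h = "assoc_inv X' Y Z \<cdot>\<^bsub>K\<^esub> ?F \<cdot>\<^bsub>K\<^esub> ?\<alpha>"
  have "Pr1 P (Prod P (X', Y)) Z \<cdot>\<^bsub>K\<^esub> ?h = (rsp (Id K X', Pr1 P Y Z) \<cdot>\<^bsub>K\<^esub> ?F) \<cdot>\<^bsub>K\<^esub> ?\<alpha>"
    by (simp add: assoc_Pr(1) flip: K.assoc)
  \<comment> \<open>Both bracketed composites equal \<open>rsp (f, Pr1 P Y Z)\<close> by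
    \<open>rsp_comp\<close>.\<close>
  also have "\<dots> = (rsp (f, Id K Y) \<cdot>\<^bsub>K\<^esub> rsp (Id K X, Pr1 P Y Z)) \<cdot>\<^bsub>K\<^esub> ?\<alpha>"
    by (simp add: rsp_comp del: K.assoc)
  also have "\<dots> = rsp (f, Id K Y) \<cdot>\<^bsub>K\<^esub> Pr1 P (Prod P (X, Y)) Z"
    by (simp add: assoc_Pr)
  finally have 1: "Pr1 P (Prod P (X', Y)) Z \<cdot>\<^bsub>K\<^esub> ?h = rsp (f, Id K Y) \<cdot>\<^bsub>K\<^esub> Pr1 P (Prod P (X, Y)) Z" .
  have "cns (Pr2 P X' (Prod P (Y, Z)) \<cdot>\<^bsub>K\<^esub> ?F) (Pr2 P X (Prod P (Y, Z)))"
    using rsp_cns [of f "Id K (Prod P (Y, Z))", OF _ _ refl refl] by simp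
  \<comment> \<open>Consistency of \<open>?F\<close> is carried along the pure arrows
    \<open>Pr2 P Y Z\<close> and \<open>?\<alpha>\<close>.\<close>
  then have "cns ((Pr2 P Y Z \<cdot>\<^bsub>K\<^esub> Pr2 P X' (Prod P (Y, Z)) \<cdot>\<^bsub>K\<^esub> ?F) \<cdot>\<^bsub>K\<^esub> ?\<alpha>)
    ((Pr2 P Y Z \<cdot>\<^bsub>K\<^esub> Pr2 P X (Prod P (Y, Z))) \<cdot>\<^bsub>K\<^esub> ?\<alpha>)"
    by (intro cns_comp_pure cns_pure_comp) simp_all
  then have 2: "cns (Pr2 P (Prod P (X', Y)) Z \<cdot>\<^bsub>K\<^esub> ?h) (Pr2 P (Prod P (X, Y)) Z)"
    by (simp add: assoc_inv_def prod_assoc_eq)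
  have "?h = rsp (rsp (f, Id K Y), Id K Z)"
    using 1 2 by (subst rsp_iff) simp_all
  then have "prod_assoc C P X' Y Z \<cdot>\<^bsub>K\<^esub> rsp (rsp (f, Id K Y), Id K Z) =
    (prod_assoc C P X' Y Z \<cdot>\<^bsub>K\<^esub> assoc_inv X' Y Z) \<cdot>\<^bsub>K\<^esub> ?F \<cdot>\<^bsub>K\<^esub> ?\<alpha>"
    by (simp del: pairing_comp)
  then show ?thesis by (simp add: assoc_inverse)
qed

text \<open>Now the arrow \<open>?F\<close> over \<open>(X \<times> Y) \<times> Z\<close> is
  conjugated and recognised as a \<open>\<ltimes>\<close>. On the first projection
  \<open>rsp_Pr1\<close> exposes the inner \<open>lsp (Id K X, f)\<close>, whose consistency
  suffices.\<close>

lemma assoc_natural2: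
  assumes f: "f \<in> Arr K" "Dom K f = Y" "Cod K f = Y'" and X: "X \<in> Obj K" and Z: "Z \<in> Obj K"
  shows "prod_assoc C P X Y' Z \<cdot>\<^bsub>K\<^esub> rsp (lsp (Id K X, f), Id K Z) =
    lsp (Id K X, rsp (f, Id K Z)) \<cdot>\<^bsub>K\<^esub> prod_assoc C P X Y Z"
proof -
  have obj [simp]: "Y \<in> Obj K" "Y' \<in> Obj K" using f by auto
  note typing [simp] = f X Z
  let ?F = "rsp (lsp (Id K X, f), Id K Z)" and ?\<beta> = "assoc_inv X Y Z"
  let ?h = "prod_assoc C P X Y' Z \<cdot>\<^bsub>K\<^esub> ?F \<cdot>\<^bsub>K\<^esub> ?\<beta>"
  have "Pr2 P X (Prod P (Y', Z)) \<cdot>\<^bsub>K\<^esub> ?h = (rsp (Pr2 P X Y', Id K Z) \<cdot>\<^bsub>K\<^esub> ?F) \<cdot>\<^bsub>K\<^esub> ?\<beta>"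
    by (simp add: assoc_Pr(4) lsp_eq_rsp flip: K.assoc)
  \<comment> \<open>Reading the pure \<open>lsp (Pr2, Id)\<close> as \<open>rsp\<close> makes
    \<open>rsp_comp\<close> applicable; both bracketed composites are
    \<open>rsp (f \<cdot> Pr2 P X Y, Id K Z)\<close>.\<close>
  also have "\<dots> = (rsp (f, Id K Z) \<cdot>\<^bsub>K\<^esub> lsp (Pr2 P X Y, Id K Z)) \<cdot>\<^bsub>K\<^esub> ?\<beta>"
    by (simp add: rsp_comp lsp_eq_rsp del: K.assoc)
  also have "\<dots> = rsp (f, Id K Z) \<cdot>\<^bsub>K\<^esub> Pr2 P X (Prod P (Y, Z))"
    by (simp add: assoc_Pr)
  finally have 1: "Pr2 P X (Prod P (Y', Z)) \<cdot>\<^bsub>K\<^esub> ?h = rsp (f, Id K Z) \<cdot>\<^bsub>K\<^esub> Pr2 P X (Prod P (Y, Z))" .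
  have "cns (Pr1 P X Y' \<cdot>\<^bsub>K\<^esub> lsp (Id K X, f)) (Pr1 P X Y)"
    using lsp_cns [of "Id K X" f, OF _ _ refl refl] by simp
  then have "cns ((Pr1 P X Y' \<cdot>\<^bsub>K\<^esub> lsp (Id K X, f)) \<cdot>\<^bsub>K\<^esub> Pr1 P (Prod P (X, Y)) Z \<cdot>\<^bsub>K\<^esub> ?\<beta>)
    (Pr1 P X Y \<cdot>\<^bsub>K\<^esub> Pr1 P (Prod P (X, Y)) Z \<cdot>\<^bsub>K\<^esub> ?\<beta>)"
    by (rule cns_comp_pure) simp_all
  then have 2: "cns (Pr1 P X (Prod P (Y', Z)) \<cdot>\<^bsub>K\<^esub> ?h) (Pr1 P X (Prod P (Y, Z)))"
    by (simp add: assoc_inv_def prod_assoc_eq)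
  have "?h = lsp (Id K X, rsp (f, Id K Z))"
    using 1 2 by (subst lsp_iff) simp_all
  then have "lsp (Id K X, rsp (f, Id K Z)) \<cdot>\<^bsub>K\<^esub> prod_assoc C P X Y Z =
    prod_assoc C P X Y' Z \<cdot>\<^bsub>K\<^esub> ?F \<cdot>\<^bsub>K\<^esub> ?\<beta> \<cdot>\<^bsub>K\<^esub> prod_assoc C P X Y Z"
    by (simp flip: \<open>?h = _\<close>)
  then show ?thesis by (simp add: assoc_inverse)
qed

text \<open>As in the first case the unnested product is conjugated, and consistency is projected
  from \<open>X \<times> Y\<close> to \<open>X\<close>.\<close>

lemma assoc_natural3:
  assumes f: "f \<in> Arr K" "Dom K f = Z" "Cod K f = Z'" and X: "X \<in> Obj K" and Y: "Y \<in> Obj K"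
  shows "prod_assoc C P X Y Z' \<cdot>\<^bsub>K\<^esub> lsp (Id K (Prod P (X, Y)), f) =
    lsp (Id K X, lsp (Id K Y, f)) \<cdot>\<^bsub>K\<^esub> prod_assoc C P X Y Z"
proof -
  have obj [simp]: "Z \<in> Obj K" "Z' \<in> Obj K" using f by auto
  note typing [simp] = f X Y
  let ?F = "lsp (Id K (Prod P (X, Y)), f)" and ?\<beta> = "assoc_inv X Y Z"
  let ?h = "prod_assoc C P X Y Z' \<cdot>\<^bsub>K\<^esub> ?F \<cdot>\<^bsub>K\<^esub> ?\<beta>"
  have "Pr2 P X (Prod P (Y, Z')) \<cdot>\<^bsub>K\<^esub> ?h = (lsp (Pr2 P X Y, Id K Z') \<cdot>\<^bsub>K\<^esub> ?F) \<cdot>\<^bsub>K\<^esub> ?\<beta>"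
    by (simp add: assoc_Pr(4) flip: K.assoc)
  \<comment> \<open>Both bracketed composites equal \<open>lsp (Pr2 P X Y, f)\<close>.\<close>
  also have "\<dots> = (lsp (Id K Y, f) \<cdot>\<^bsub>K\<^esub> lsp (Pr2 P X Y, Id K Z)) \<cdot>\<^bsub>K\<^esub> ?\<beta>"
    by (simp add: lsp_comp del: K.assoc)
  also have "\<dots> = lsp (Id K Y, f) \<cdot>\<^bsub>K\<^esub> Pr2 P X (Prod P (Y, Z))"
    by (simp add: assoc_Pr)
  finally have 1: "Pr2 P X (Prod P (Y, Z')) \<cdot>\<^bsub>K\<^esub> ?h = lsp (Id K Y, f) \<cdot>\<^bsub>K\<^esub> Pr2 P X (Prod P (Y, Z))" .
  have "cns (Pr1 P (Prod P (X, Y)) Z' \<cdot>\<^bsub>K\<^esub> ?F) (Pr1 P (Prod P (X, Y)) Z)"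
    using lsp_cns [of "Id K (Prod P (X, Y))" f, OF _ _ refl refl] by simp
  then have "cns ((Pr1 P X Y \<cdot>\<^bsub>K\<^esub> Pr1 P (Prod P (X, Y)) Z' \<cdot>\<^bsub>K\<^esub> ?F) \<cdot>\<^bsub>K\<^esub> ?\<beta>)
    ((Pr1 P X Y \<cdot>\<^bsub>K\<^esub> Pr1 P (Prod P (X, Y)) Z) \<cdot>\<^bsub>K\<^esub> ?\<beta>)"
    by (intro cns_comp_pure cns_pure_comp) simp_all
  then have 2: "cns (Pr1 P X (Prod P (Y, Z')) \<cdot>\<^bsub>K\<^esub> ?h) (Pr1 P X (Prod P (Y, Z)))"
    by (simp add: assoc_inv_def prod_assoc_eq)
  have "?h = lsp (Id K X, lsp (Id K Y, f))"
    using 1 2 by (subst lsp_iff) simp_all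
  then have "lsp (Id K X, lsp (Id K Y, f)) \<cdot>\<^bsub>K\<^esub> prod_assoc C P X Y Z =
    prod_assoc C P X Y Z' \<cdot>\<^bsub>K\<^esub> ?F \<cdot>\<^bsub>K\<^esub> ?\<beta> \<cdot>\<^bsub>K\<^esub> prod_assoc C P X Y Z"
    by (simp flip: \<open>?h = _\<close>)
  then show ?thesis by (simp add: assoc_inverse)
qed

text \<open>Conjugation by the symmetry exchanges the two projections, which turns the conditions
  for \<open>\<rtimes>\<close> into those for \<open>\<ltimes>\<close>.\<close>

lemma swap_natural1:
  assumes f: "f \<in> Arr K" "Dom K f = X" "Cod K f = X'" and Y: "Y \<in> Obj K"
  shows "prod_swap C P X' Y \<cdot>\<^bsub>K\<^esub> rsp (f, Id K Y) = lsp (Id K Y, f) \<cdot>\<^bsub>K\<^esub> prod_swap C P X Y"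
proof -
  have obj [simp]: "X \<in> Obj K" "X' \<in> Obj K" using f by auto
  note typing [simp] = f Y
  let ?h = "prod_swap C P X' Y \<cdot>\<^bsub>K\<^esub> rsp (f, Id K Y) \<cdot>\<^bsub>K\<^esub> prod_swap C P Y X"
  have "cns (Pr2 P X' Y \<cdot>\<^bsub>K\<^esub> rsp (f, Id K Y)) (Pr2 P X Y)"
    using rsp_cns [of f "Id K Y", OF _ _ refl refl] by simp
  then have "cns ((Pr2 P X' Y \<cdot>\<^bsub>K\<^esub> rsp (f, Id K Y)) \<cdot>\<^bsub>K\<^esub> prod_swap C P Y X)
    (Pr2 P X Y \<cdot>\<^bsub>K\<^esub> prod_swap C P Y X)"
    by (rule cns_comp_pure) simp_all
  then have "cns (Pr1 P Y X' \<cdot>\<^bsub>K\<^esub> ?h) (Pr1 P Y X)"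
    by (simp add: prod_swap_def)
  moreover have "Pr2 P Y X' \<cdot>\<^bsub>K\<^esub> ?h = f \<cdot>\<^bsub>K\<^esub> Pr2 P Y X"
    by (simp add: prod_swap_def)
  ultimately have "?h = lsp (Id K Y, f)"
    by (subst lsp_iff) simp_all
  then have "lsp (Id K Y, f) \<cdot>\<^bsub>K\<^esub> prod_swap C P X Y =
    prod_swap C P X' Y \<cdot>\<^bsub>K\<^esub> rsp (f, Id K Y) \<cdot>\<^bsub>K\<^esub> prod_swap C P Y X \<cdot>\<^bsub>K\<^esub> prod_swap C P X Y"
    by (simp flip: \<open>?h = _\<close>)
  then show ?thesis by (simp add: swap_inverse)
qed

text \<open>Transported from \<open>swap_natural1\<close>, the symmetry being inverse to itself;
  uniqueness is not invoked again.\<close>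

lemma swap_natural2:
  assumes f: "f \<in> Arr K" "Dom K f = Y" "Cod K f = Y'" and X: "X \<in> Obj K"
  shows "prod_swap C P X Y' \<cdot>\<^bsub>K\<^esub> lsp (Id K X, f) = rsp (f, Id K X) \<cdot>\<^bsub>K\<^esub> prod_swap C P X Y"
proof -
  have obj [simp]: "Y \<in> Obj K" "Y' \<in> Obj K" using f by auto
  note typing [simp] = f X
  have "prod_swap C P X Y' \<cdot>\<^bsub>K\<^esub> lsp (Id K X, f) =
    prod_swap C P X Y' \<cdot>\<^bsub>K\<^esub> (lsp (Id K X, f) \<cdot>\<^bsub>K\<^esub> prod_swap C P Y X) \<cdot>\<^bsub>K\<^esub> prod_swap C P X Y"
    by (simp add: swap_inverse)
  also have "\<dots> = (prod_swap C P X Y' \<cdot>\<^bsub>K\<^esub> prod_swap C P Y' X) \<cdot>\<^bsub>K\<^esub> rsp (f, Id K X) \<cdot>\<^bsub>K\<^esub> prod_swap C P X Y"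
    unfolding swap_natural1 [OF f X, symmetric] by simp
  also have "\<dots> = rsp (f, Id K X) \<cdot>\<^bsub>K\<^esub> prod_swap C P X Y"
    by (simp add: swap_inverse)
  finally show ?thesis .
qed

section \<open>Terminal maps, unit isomorphisms and coherence\<close>

lemma bang_pure [simp]:
  assumes "X \<in> Obj K"
  shows "bang C (One P) X \<in> Arr C" "Dom K (bang C (One P) X) = X" "Cod K (bang C (One P) X) = One P"
proof -
  have "\<exists>!u. u \<in> hom C X (One P)"
    using terminal_One assms by (simp add: terminal_def)
  then have "bang C (One P) X \<in> hom C X (One P)"
    unfolding bang_def by (rule theI')
  then show "bang C (One P) X \<in> Arr C" "Dom K (bang C (One P) X) = X" "Cod K (bang C (One P) X) = One P"
    by (simp_all add: hom_C)
qed

text \<open>Terminality turns \<open>bang\<close> after one projection into the other projection,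
  and pairing the two projections gives the identity.\<close>

lemma unit_inverse:
  assumes [simp]: "X \<in> Obj K"
  shows "pairing C P (Id K X) (bang C (One P) X) \<cdot>\<^bsub>K\<^esub> prod_l P X = Id K (Prod P (X, One P))"
    "prod_l P X \<cdot>\<^bsub>K\<^esub> pairing C P (Id K X) (bang C (One P) X) = Id K X"
    "pairing C P (bang C (One P) X) (Id K X) \<cdot>\<^bsub>K\<^esub> prod_r P X = Id K (Prod P (One P, X))"
    "prod_r P X \<cdot>\<^bsub>K\<^esub> pairing C P (bang C (One P) X) (Id K X) = Id K X"
proof -
  have "bang C (One P) X \<cdot>\<^bsub>K\<^esub> Pr1 P X (One P) = Pr2 P X (One P)"
    "bang C (One P) X \<cdot>\<^bsub>K\<^esub> Pr2 P (One P) X = Pr1 P (One P) X"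
    by (rule terminal_eq; simp)+
  then show "pairing C P (Id K X) (bang C (One P) X) \<cdot>\<^bsub>K\<^esub> prod_l P X = Id K (Prod P (X, One P))"
    "prod_l P X \<cdot>\<^bsub>K\<^esub> pairing C P (Id K X) (bang C (One P) X) = Id K X"
    "pairing C P (bang C (One P) X) (Id K X) \<cdot>\<^bsub>K\<^esub> prod_r P X = Id K (Prod P (One P, X))"
    "prod_r P X \<cdot>\<^bsub>K\<^esub> pairing C P (bang C (One P) X) (Id K X) = Id K X"
    by (simp_all add: prod_l_def prod_r_def)
qed

text \<open>All structural maps are pure, so coherence is a matter of equations in \<open>C\<close>;
  impure arrows enter only through the naturality squares.\<close>

lemma symmetric_premonoidal: "symmetric_premonoidal K S"
proof (rule symmetric_premonoidal.intro [OF binoidal], unfold symmetric_premonoidal_axioms_def S_simps,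
    intro conjI allI impI)
  show "One P \<in> Obj K" by simp
next
  fix Y Z assume [simp]: "Y \<in> Obj K" "Z \<in> Obj K"
  show "central_natural_iso K S (\<lambda>X. Prod P (Prod P (X, Y), Z)) (\<lambda>f. rwh K S (rwh K S f Y) Z)
    (\<lambda>X. Prod P (X, Prod P (Y, Z))) (\<lambda>f. rwh K S f (Prod P (Y, Z))) (\<lambda>X. prod_assoc C P X Y Z)"
    by (rule central_natural_isoI [where u = "\<lambda>X. assoc_inv X Y Z"])
      (auto intro!: assoc_natural1 is_functor_comp [OF rwh_functor rwh_functor] rwh_functor
        simp: assoc_inverse)
next
  fix X Z assume [simp]: "X \<in> Obj K" "Z \<in> Obj K"
  show "central_natural_iso K S (\<lambda>Y. Prod P (Prod P (X, Y), Z)) (\<lambda>f. rwh K S (lwh K S X f) Z)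
    (\<lambda>Y. Prod P (X, Prod P (Y, Z))) (\<lambda>f. lwh K S X (rwh K S f Z)) (\<lambda>Y. prod_assoc C P X Y Z)"
    by (rule central_natural_isoI [where u = "\<lambda>Y. assoc_inv X Y Z"])
      (auto intro!: assoc_natural2 is_functor_comp [OF lwh_functor rwh_functor]
        is_functor_comp [OF rwh_functor lwh_functor] simp: assoc_inverse)
next
  fix X Y assume [simp]: "X \<in> Obj K" "Y \<in> Obj K"
  show "central_natural_iso K S (\<lambda>Z. Prod P (Prod P (X, Y), Z)) (\<lambda>f. lwh K S (Prod P (X, Y)) f)
    (\<lambda>Z. Prod P (X, Prod P (Y, Z))) (\<lambda>f. lwh K S X (lwh K S Y f)) (\<lambda>Z. prod_assoc C P X Y Z)"
    by (rule central_natural_isoI [where u = "\<lambda>Z. assoc_inv X Y Z"])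
      (auto intro!: assoc_natural3 is_functor_comp [OF lwh_functor lwh_functor] lwh_functor
        simp: assoc_inverse)
next
  show "central_natural_iso K S (\<lambda>X. Prod P (X, One P)) (\<lambda>f. rwh K S f (One P)) (\<lambda>X. X) (\<lambda>f. f) (prod_l P)"
  proof (rule central_natural_isoI [where u = "\<lambda>X. pairing C P (Id K X) (bang C (One P) X)"])
    \<comment> \<open>The left unit is a projection, so its naturality is the strict projection law
      \<open>rsp_Pr1\<close>; for the right unit it is \<open>lsp_Pr2\<close>.\<close>
    show "prod_l P (Cod K f) \<cdot>\<^bsub>K\<^esub> rwh K S f (One P) = f \<cdot>\<^bsub>K\<^esub> prod_l P (Dom K f)" if "f \<in> Arr K" for f
      using that by (simp add: prod_l_def)
  qed (auto intro!: rwh_functor Id_functor simp: unit_inverse simp del: pairing_comp)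
  show "central_natural_iso K S (\<lambda>X. Prod P (One P, X)) (\<lambda>f. lwh K S (One P) f) (\<lambda>X. X) (\<lambda>f. f) (prod_r P)"
  proof (rule central_natural_isoI [where u = "\<lambda>X. pairing C P (bang C (One P) X) (Id K X)"])
    show "prod_r P (Cod K f) \<cdot>\<^bsub>K\<^esub> lwh K S (One P) f = f \<cdot>\<^bsub>K\<^esub> prod_r P (Dom K f)" if "f \<in> Arr K" for f
      using that by (simp add: prod_r_def)
  qed (auto intro!: lwh_functor Id_functor simp: unit_inverse simp del: pairing_comp)
next
  fix Y assume [simp]: "Y \<in> Obj K"
  show "central_natural_iso K S (\<lambda>X. Prod P (X, Y)) (\<lambda>f. rwh K S f Y) (\<lambda>X. Prod P (Y, X)) (\<lambda>f. lwh K S Y f)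
    (\<lambda>X. prod_swap C P X Y)"
    by (rule central_natural_isoI [where u = "\<lambda>X. prod_swap C P Y X"])
      (auto intro!: swap_natural1 rwh_functor lwh_functor
        simp: swap_inverse)
next
  fix X assume [simp]: "X \<in> Obj K"
  show "central_natural_iso K S (\<lambda>Y. Prod P (X, Y)) (\<lambda>f. lwh K S X f) (\<lambda>Y. Prod P (Y, X)) (\<lambda>f. rwh K S f X)
    (\<lambda>Y. prod_swap C P X Y)"
    by (rule central_natural_isoI [where u = "\<lambda>Y. prod_swap C P Y X"])
      (auto intro!: swap_natural2 rwh_functor lwh_functor
        simp: swap_inverse)
next
  fix W X Y Z assume "W \<in> Obj K" "X \<in> Obj K" "Y \<in> Obj K" "Z \<in> Obj K"
  \<comment> \<open>Whiskerings become pairings while the associators are still folded, so that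
    \<open>assoc_typing\<close> computes their types; only then are they unfolded and compared as
    pairings.\<close>
  then show "prod_assoc C P W X (Prod P (Y, Z)) \<cdot>\<^bsub>K\<^esub> prod_assoc C P (Prod P (W, X)) Y Z =
    lwh K S W (prod_assoc C P X Y Z) \<cdot>\<^bsub>K\<^esub> prod_assoc C P W (Prod P (X, Y)) Z \<cdot>\<^bsub>K\<^esub>
      rwh K S (prod_assoc C P W X Y) Z"
    by (simp add: lsp_pure rsp_pure prod_arr_eq) (simp add: prod_assoc_eq)
next
  fix X Y assume [simp]: "X \<in> Obj K" "Y \<in> Obj K"
  show "lwh K S X (prod_r P Y) \<cdot>\<^bsub>K\<^esub> prod_assoc C P X (One P) Y = rwh K S (prod_l P X) Y"
    by (simp add: lsp_pure rsp_pure prod_arr_eq) (simp add: prod_assoc_eq prod_l_def prod_r_def)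
next
  show "prod_l P (One P) = prod_r P (One P)"
    by (rule terminal_eq) simp_all
next
  fix X Y Z assume "X \<in> Obj K" "Y \<in> Obj K" "Z \<in> Obj K"
  then show "prod_assoc C P Y Z X \<cdot>\<^bsub>K\<^esub> prod_swap C P X (Prod P (Y, Z)) \<cdot>\<^bsub>K\<^esub> prod_assoc C P X Y Z =
    lwh K S Y (prod_swap C P X Z) \<cdot>\<^bsub>K\<^esub> prod_assoc C P Y X Z \<cdot>\<^bsub>K\<^esub> rwh K S (prod_swap C P X Y) Z"
    by (simp add: lsp_pure rsp_pure prod_arr_eq) (simp add: prod_assoc_eq prod_swap_def)
next
  fix X Y assume "X \<in> Obj K" "Y \<in> Obj K"
  then show "prod_swap C P Y X \<cdot>\<^bsub>K\<^esub> prod_swap C P X Y = Id K (Prod P (X, Y))"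
    by (rule swap_inverse)
next
  fix X assume "X \<in> Obj K"
  then show "prod_r P X \<cdot>\<^bsub>K\<^esub> prod_swap C P X (One P) = prod_l P X"
    by (simp add: prod_swap_def prod_l_def prod_r_def)
qed

end

section \<open>The pure category as its own effect category\<close>

context finite_products
begin

text \<open>Makes the product calculus available with \<open>K = C\<close> before any consistency
  relation on \<open>C\<close> has been chosen.\<close>

lemma pure_products_self: "pure_products C C P"
proof -
  have "wide_subcategory C C" by unfold_locales simp_all
  then show ?thesis by (intro pure_products.intro finite_products_axioms)
qed

text \<open>For equality as consistency, complementarity is immediate and both semi-pure products
  are \<open>\<times>\<close>, by its universal property. The conjunct \<open>v \<in> Arr C\<close>
  secures \<open>cns_typed\<close>.\<close>

lemma pure_cartesian_effect_category:
  "cartesian_effect_category C C P (\<lambda>f v. f = v \<and> v \<in> Arr C) (prod_arr C P) (prod_arr C P)"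
proof -
  note unique = pure_products.prod_arr_unique [OF pure_products_self]
  have graph: "graph_hom (prod_cat C C) C (Prod P) (prod_arr C P)"
    using pure_products.prod_arr_hom [OF pure_products_self]
    by (auto simp: graph_hom_def prod_cat_def Prod_obj)
  show ?thesis
  proof (unfold_locales, goal_cases)
    \<comment> \<open>Cases 14 and 15 are the uniqueness axioms of the semi-pure products.
      Consistency includes purity of its right-hand side, which is supplied first.\<close>
    case (14 f X1 Y1 g X2 Y2 h)
    then have "f \<cdot>\<^bsub>C\<^esub> Pr1 P X1 X2 \<in> Arr C"
      using Pr1_hom [of X1 X2] by (auto simp: hom_def)
    then show ?case
      using unique [OF 14] by auto
  next
    case (15 f X1 Y1 g X2 Y2 h)
    then have "g \<cdot>\<^bsub>C\<^esub> Pr2 P X1 X2 \<in> Arr C"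
      using Pr2_hom [of X1 X2] by (auto simp: hom_def)
    then show ?case
      using unique [OF 15] by auto
  qed (use terminal_One graph in \<open>auto simp: hom_def consistent_def\<close>)
qed

text \<open>The product structure is the sequential structure of the degenerate effect category, so
  the result for \<open>K\<close> applies to \<open>C\<close>.\<close>

lemma prod_symmetric_premonoidal: "symmetric_premonoidal C (prod_premonoidal C P)"
proof -
  \<comment> \<open>Both tensors are restricted to the same set of pairs, so agreement there gives
    equality of functions.\<close>
  have "LTens (prod_premonoidal C P) = LTens (seq_premonoidal C C P (prod_arr C P) (prod_arr C P))"
    "RTens (prod_premonoidal C P) = RTens (seq_premonoidal C C P (prod_arr C P) (prod_arr C P))"
    using cartesian_effect_category.seq_left_lsp [OF pure_cartesian_effect_category]
      cartesian_effect_category.seq_right_rsp [OF pure_cartesian_effect_category]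
    by (auto simp: prod_premonoidal_def seq_premonoidal_def prod_cat_def discr_def fun_eq_iff restrict_def)
  then have "prod_premonoidal C P = seq_premonoidal C C P (prod_arr C P) (prod_arr C P)"
    by (simp add: prod_premonoidal_def seq_premonoidal_def)
  then show ?thesis
    using cartesian_effect_category.symmetric_premonoidal [OF pure_cartesian_effect_category] by simp
qed

end

section \<open>The inclusion as a Freyd-category\<close>

context cartesian_effect_category
begin

text \<open>Objects and structural maps are shared, and the tensors agree on pure arrows because
  both semi-pure products extend \<open>\<times>\<close>.\<close>

lemma freyd: "freyd_category C P K S (\<lambda>f. f)"
proof -
  have "symmetric_premonoidal_functor_axioms C (prod_premonoidal C P) K S (\<lambda>X. X) (\<lambda>f. f)"
  proof
    show "is_functor C K (\<lambda>X. X) (\<lambda>f. f)"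
      using K.category_axioms C.category_axioms
      by (auto simp: is_functor_def graph_hom_def hom_def)
  qed (auto simp: prod_premonoidal_def prod_cat_def discr_def lsp_pure rsp_pure)
  \<comment> \<open>Centrality in \<open>C\<close> includes membership in \<open>Arr C\<close>,
    whence \<open>pure_central\<close> gives centrality in \<open>K\<close>.\<close>
  moreover have "strict_symmetric_premonoidal_functor_axioms C (prod_premonoidal C P) K S (\<lambda>f. f)"
    by unfold_locales (auto simp: central_def [of C] intro: pure_central)
  ultimately show ?thesis
    by (intro freyd_category.intro freyd_category_axioms.intro strict_symmetric_premonoidal_functor.intro
        symmetric_premonoidal_functor.intro symmetric_premonoidal prod_symmetric_premonoidal
        finite_products_axioms) simp_all
qed

end

theorem theorem16:
  fixes K :: "('o, 'm) cat" and C :: "('o, 'm) cat" and P :: "('o, 'm) fprod"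
    and cns :: "'m \<Rightarrow> 'm \<Rightarrow> bool" and lsp rsp :: "'m \<times> 'm \<Rightarrow> 'm"
  assumes "cartesian_effect_category K C P cns lsp rsp"
  shows "freyd_category C P K (seq_premonoidal K C P lsp rsp) (\<lambda>f. f) \<and>
    (\<forall>f1 \<in> Arr K. \<forall>f2 \<in> Arr K.
      fr_left K (seq_premonoidal K C P lsp rsp) (f1, f2) = seq_left K lsp rsp (f1, f2) \<and>
      fr_right K (seq_premonoidal K C P lsp rsp) (f1, f2) = seq_right K lsp rsp (f1, f2))"
proof -
  interpret cartesian_effect_category K C P cns lsp rsp by fact
  show ?thesis using freyd fr_eq by blast
qed

end
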